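(* Let $A$ be a unital locally $C^{\ast}$-algebra. Then $A$ is an annihilator algebra if and only if $A$ is topologically ${}^{\ast}$-isomorphic to the Cartesian product (with product topology) of a family of full matrix algebras $M_{n_\nu}(\mathbb{C})$.
   Context: A locally $C^{\ast}$-algebra is a complete Hausdorff locally convex ${}^{\ast}$-algebra over $\mathbb{C}$ with jointly continuous multiplication whose topology is given by a family of $C^{\ast}$-seminorms. $A$ is an annihilator algebra if for every closed left ideal $J$ and closed right ideal $K$: $\mathrm{ran}(J)=0\iff J=A$ and $\mathrm{lan}(K)=0\iff K=A$, where $\mathrm{lan}(S)=\{a:aS=0\}$, $\mathrm{ran}(S)=\{a:Sa=0\}$. (For locally $C^{\ast}$-algebras this is equivalent to: all irreducible Hermitian $A$-modules are projective; $\mathrm{Soc}(A)$ is dense; $A$ is dual; etc.) *)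

theory Defs
  imports "HOL-Analysis.Analysis"
begin

definition complex_algebra_ops :: "(complex \<Rightarrow> 'a::ring_1 \<Rightarrow> 'a) \<Rightarrow> bool" where
  "complex_algebra_ops smul \<longleftrightarrow>
     (\<forall>c x y. smul c (x + y) = smul c x + smul c y) \<and>
     (\<forall>c d x. smul (c + d) x = smul c x + smul d x) \<and>
     (\<forall>c d x. smul (c * d) x = smul c (smul d x)) \<and>
     (\<forall>x. smul 1 x = x) \<and>
     (\<forall>c x y. smul c (x * y) = smul c x * y) \<and>
     (\<forall>c x y. smul c (x * y) = x * smul c y)"

definition involution :: "(complex \<Rightarrow> 'a::ring_1 \<Rightarrow> 'a) \<Rightarrow> ('a \<Rightarrow> 'a) \<Rightarrow> bool" where
  "involution smul star \<longleftrightarrow>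
     (\<forall>x y. star (x + y) = star x + star y) \<and>
     (\<forall>c x. star (smul c x) = smul (cnj c) (star x)) \<and>
     (\<forall>x y. star (x * y) = star y * star x) \<and>
     (\<forall>x. star (star x) = x)"

definition cstar_seminorm ::
  "(complex \<Rightarrow> 'a::ring_1 \<Rightarrow> 'a) \<Rightarrow> ('a \<Rightarrow> 'a) \<Rightarrow> ('a \<Rightarrow> real) \<Rightarrow> bool" where
  "cstar_seminorm smul star p \<longleftrightarrow>
     (\<forall>x y. p (x + y) \<le> p x + p y) \<and>
     (\<forall>c x. p (smul c x) = cmod c * p x) \<and>
     (\<forall>x y. p (x * y) \<le> p x * p y) \<and>
     (\<forall>x. p (star x * x) = (p x)\<^sup>2)"

definition seminorm_topology :: "('a::ab_group_add \<Rightarrow> real) set \<Rightarrow> 'a topology" where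
  "seminorm_topology P = topology (\<lambda>U. \<forall>x\<in>U. \<exists>F e. finite F \<and> F \<subseteq> P \<and> e > 0 \<and>
       {y. \<forall>p\<in>F. p (y - x) < e} \<subseteq> U)"

definition sn_cauchy :: "('a::ab_group_add \<Rightarrow> real) set \<Rightarrow> 'a filter \<Rightarrow> bool" where
  "sn_cauchy P F \<longleftrightarrow> F \<noteq> bot \<and>
     (\<forall>p\<in>P. \<forall>e>0. eventually (\<lambda>(x, y). p (x - y) < e) (F \<times>\<^sub>F F))"

definition sn_converges :: "('a::ab_group_add \<Rightarrow> real) set \<Rightarrow> 'a filter \<Rightarrow> 'a \<Rightarrow> bool" where
  "sn_converges P F a \<longleftrightarrow> (\<forall>p\<in>P. \<forall>e>0. eventually (\<lambda>x. p (x - a) < e) F)"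

text \<open>Completeness of the uniform structure (every Cauchy filter, equivalently every Cauchy net, converges).\<close>
definition sn_complete :: "('a::ab_group_add \<Rightarrow> real) set \<Rightarrow> bool" where
  "sn_complete P \<longleftrightarrow> (\<forall>F. sn_cauchy P F \<longrightarrow> (\<exists>a. sn_converges P F a))"

definition locally_cstar_algebra ::
  "(complex \<Rightarrow> 'a::ring_1 \<Rightarrow> 'a) \<Rightarrow> ('a \<Rightarrow> 'a) \<Rightarrow> ('a \<Rightarrow> real) set \<Rightarrow> bool" where
  "locally_cstar_algebra smul star P \<longleftrightarrow>
     complex_algebra_ops smul \<and> involution smul star \<and>
     (\<forall>p\<in>P. cstar_seminorm smul star p) \<and>
     (\<forall>x. x \<noteq> 0 \<longrightarrow> (\<exists>p\<in>P. p x \<noteq> 0)) \<and>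
     sn_complete P \<and>
     continuous_map (prod_topology (seminorm_topology P) (seminorm_topology P))
        (seminorm_topology P) (\<lambda>(x, y). x * y)"

definition left_ideal :: "(complex \<Rightarrow> 'a::ring_1 \<Rightarrow> 'a) \<Rightarrow> 'a set \<Rightarrow> bool" where
  "left_ideal smul J \<longleftrightarrow> 0 \<in> J \<and> (\<forall>x\<in>J. \<forall>y\<in>J. x + y \<in> J) \<and>
     (\<forall>c. \<forall>x\<in>J. smul c x \<in> J) \<and> (\<forall>a. \<forall>x\<in>J. a * x \<in> J)"

definition right_ideal :: "(complex \<Rightarrow> 'a::ring_1 \<Rightarrow> 'a) \<Rightarrow> 'a set \<Rightarrow> bool" where
  "right_ideal smul K \<longleftrightarrow> 0 \<in> K \<and> (\<forall>x\<in>K. \<forall>y\<in>K. x + y \<in> K) \<and>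
     (\<forall>c. \<forall>x\<in>K. smul c x \<in> K) \<and> (\<forall>a. \<forall>x\<in>K. x * a \<in> K)"

definition lan :: "'a::ring_1 set \<Rightarrow> 'a set" where
  "lan S = {a. \<forall>s\<in>S. a * s = 0}"

definition ran :: "'a::ring_1 set \<Rightarrow> 'a set" where
  "ran S = {a. \<forall>s\<in>S. s * a = 0}"

definition annihilator_algebra ::
  "(complex \<Rightarrow> 'a::ring_1 \<Rightarrow> 'a) \<Rightarrow> ('a \<Rightarrow> real) set \<Rightarrow> bool" where
  "annihilator_algebra smul P \<longleftrightarrow>
     (\<forall>J. left_ideal smul J \<and> closedin (seminorm_topology P) J \<longrightarrow> (ran J = {0} \<longleftrightarrow> J = UNIV)) \<and>
     (\<forall>K. right_ideal smul K \<and> closedin (seminorm_topology P) K \<longrightarrow> (lan K = {0} \<longleftrightarrow> K = UNIV))"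

text \<open>An m x m complex matrix is represented as a function nat => nat => complex
  vanishing outside {0..<m} x {0..<m}.\<close>
definition mat_carrier :: "nat \<Rightarrow> (nat \<Rightarrow> nat \<Rightarrow> complex) set" where
  "mat_carrier m = {a. \<forall>j k. (m \<le> j \<or> m \<le> k) \<longrightarrow> a j k = 0}"

definition mat_mult :: "nat \<Rightarrow> (nat \<Rightarrow> nat \<Rightarrow> complex) \<Rightarrow> (nat \<Rightarrow> nat \<Rightarrow> complex) \<Rightarrow> (nat \<Rightarrow> nat \<Rightarrow> complex)" where
  "mat_mult m a b = (\<lambda>j k. if j < m \<and> k < m then (\<Sum>l<m. a j l * b l k) else 0)"

definition mat_adj :: "nat \<Rightarrow> (nat \<Rightarrow> nat \<Rightarrow> complex) \<Rightarrow> (nat \<Rightarrow> nat \<Rightarrow> complex)" where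
  "mat_adj m a = (\<lambda>j k. if j < m \<and> k < m then cnj (a k j) else 0)"

definition prod_mat_topology :: "'i set \<Rightarrow> ('i \<Rightarrow> nat) \<Rightarrow> ('i \<Rightarrow> nat \<Rightarrow> nat \<Rightarrow> complex) topology" where
  "prod_mat_topology I n = product_topology (\<lambda>v. subtopology euclidean (mat_carrier (n v))) I"

definition top_star_iso_prod_mat ::
  "(complex \<Rightarrow> 'a::ring_1 \<Rightarrow> 'a) \<Rightarrow> ('a \<Rightarrow> 'a) \<Rightarrow> ('a \<Rightarrow> real) set \<Rightarrow>
   'i set \<Rightarrow> ('i \<Rightarrow> nat) \<Rightarrow> ('a \<Rightarrow> 'i \<Rightarrow> nat \<Rightarrow> nat \<Rightarrow> complex) \<Rightarrow> bool" where
  "top_star_iso_prod_mat smul star P I n f \<longleftrightarrow>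
     homeomorphic_map (seminorm_topology P) (prod_mat_topology I n) f \<and>
     (\<forall>x y. f (x + y) = (\<lambda>v\<in>I. \<lambda>j k. f x v j k + f y v j k)) \<and>
     (\<forall>c x. f (smul c x) = (\<lambda>v\<in>I. \<lambda>j k. c * f x v j k)) \<and>
     (\<forall>x y. f (x * y) = (\<lambda>v\<in>I. mat_mult (n v) (f x v) (f y v))) \<and>
     (\<forall>x. f (star x) = (\<lambda>v\<in>I. mat_adj (n v) (f x v)))"

end

theory Submission
  imports Defs "HOL-Library.Function_Algebras"
begin

text \<open>
  Let \<open>M\<close> be a left ideal that is maximal among those avoiding \<open>{x. q (1 - x) < 1}\<close> for a continuous
  \<open>C\<^sup>*\<close>-seminorm \<open>q\<close>. It is closed, so \<open>R = ran M\<close> is nonzero, and every nonzero self-adjoint element of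
  \<open>R\<close> has left annihilator \<open>M\<close>. Hence \<open>R\<close> contains no two nonzero self-adjoint elements with product 0;
  since \<open>x = \<bar>x\<bar>\<close> or \<open>x = -\<bar>x\<bar>\<close> for every bounded self-adjoint \<open>x\<close> in \<open>R\<close>, moving \<open>\<lambda>\<close> in \<open>k\<^sup>2 - \<lambda> k\<close> gives
  \<open>k\<^sup>2 = \<lambda> k\<close> for some \<open>\<lambda>\<close>, and \<open>R\<close> contains a minimal projection. Consequently the left ideal generated
  by the minimal projections is dense. Because \<open>A\<close> is unital, for every \<open>q\<close> some finite sum of multiples of
  minimal projections lies at \<open>q\<close>-distance less than 1 from 1. This makes \<open>A e\<close> finite-dimensional for every
  minimal projection \<open>e\<close> and shows that only finitely many of the minimal central projections
  \<open>z = \<Sum>\<^sub>i u\<^sub>i u\<^sub>i\<^sup>*\<close> (\<open>u\<close> an orthonormal basis of \<open>A e\<close>) are not in the kernel of \<open>q\<close>. Since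
  \<open>z A\<close> is a full matrix algebra, completeness gives \<open>A \<cong> \<Prod>\<^sub>z z A\<close>. The square roots and inverses needed on
  the way are obtained from iterations that are dominated by scalar ones, without spectral theory.
  Conversely, in a product of matrix algebras a closed left ideal without right annihilator contains every
  component, hence the dense direct sum.
\<close>

subsection \<open>\<open>C\<^sup>*\<close>-seminorms\<close>

locale star_algebra =
  fixes smul :: "complex \<Rightarrow> 'a::ring_1 \<Rightarrow> 'a" and star :: "'a \<Rightarrow> 'a"
  assumes ops: "complex_algebra_ops smul" and invol: "involution smul star"
begin

sublocale vector_space smul
  using ops unfolding complex_algebra_ops_def by unfold_locales auto

lemma mult_smul_left [simp]: "smul c x * y = smul c (x * y)"
  and mult_smul_right [simp]: "x * smul c y = smul c (x * y)"
  using ops unfolding complex_algebra_ops_def by metis+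

lemma star_add [simp]: "star (x + y) = star x + star y"
  and star_smul [simp]: "star (smul c x) = smul (cnj c) (star x)"
  and star_mult [simp]: "star (x * y) = star y * star x"
  and star_star [simp]: "star (star x) = x"
  using invol unfolding involution_def by auto

lemma star_zero [simp]: "star 0 = 0"
  using star_add[of 0 0] by simp

lemma star_one [simp]: "star 1 = 1"
  using star_mult[of "star 1" 1] by simp

lemma star_minus [simp]: "star (- x) = - star x"
  using star_add[of x "- x"] by (simp add: eq_neg_iff_add_eq_0 add.commute)

lemma star_diff [simp]: "star (x - y) = star x - star y"
  using star_add[of x "- y"] by simp

lemma star_sum [simp]: "star (sum g S) = (\<Sum>i\<in>S. star (g i))"
  by (induction S rule: infinite_finite_induct) auto

lemma smul_two: "smul 2 x = x + x"
  using scale_left_distrib[of 1 1 x] by simp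

lemma real_imag_decomposition:
  obtains x1 x2 where "star x1 = x1" "star x2 = x2" "x = x1 + smul \<i> x2"
proof
  show "star (smul (1/2) (x + star x)) = smul (1/2) (x + star x)"
    by (simp add: add.commute)
  show "star (smul (-\<i>/2) (x - star x)) = smul (-\<i>/2) (x - star x)"
    by (simp add: scale_right_diff_distrib)
  have "smul (1/2) x + smul (1/2) x = x"
    using scale_left_distrib[of "1/2" "1/2" x] by simp
  then show "x = smul (1/2) (x + star x) + smul \<i> (smul (-\<i>/2) (x - star x))"
    by (simp add: scale_right_diff_distrib scale_right_distrib)
qed

abbreviation cs :: "('a \<Rightarrow> real) \<Rightarrow> bool" where
  "cs p \<equiv> cstar_seminorm smul star p"

context
  fixes p assumes p: "cs p"
begin

lemma cs_triangle: "p (x + y) \<le> p x + p y"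
  and cs_smul: "p (smul c x) = cmod c * p x"
  and cs_mult: "p (x * y) \<le> p x * p y"
  and cs_star_mult: "p (star x * x) = (p x)\<^sup>2"
  using p unfolding cstar_seminorm_def by auto

lemma cs_zero: "p 0 = 0"
  using cs_smul[of 0 0] by simp

lemma cs_minus: "p (- x) = p x"
  using cs_smul[of "-1" x] by simp

lemma cs_nonneg: "0 \<le> p x"
  using cs_triangle[of x "- x"] cs_zero cs_minus by simp

lemma cs_diff_commute: "p (x - y) = p (y - x)"
  using cs_minus[of "x - y"] by simp

lemma cs_diff_triangle: "p (x - z) \<le> p (x - y) + p (y - z)"
  using cs_triangle[of "x - y" "y - z"] by simp

lemma cs_diff_le: "p (x - y) \<le> p x + p y"
  using cs_triangle[of x "- y"] cs_minus by simp

lemma cs_le_add_diff: "p x \<le> p y + p (x - y)"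
  using cs_triangle[of y "x - y"] by simp

lemma cs_sum_le: "p (sum g S) \<le> (\<Sum>i\<in>S. p (g i))"
proof (induction S rule: infinite_finite_induct)
  case (insert x F)
  then show ?case using cs_triangle[of "g x" "sum g F"] by simp
qed (auto simp: cs_zero)

text \<open>The C*-identity gives (p x)^2 \<le> p (star x) * p x. Cancel p x, then exchange x and
  \<open>star x\<close> for the reverse inequality.\<close>

lemma cs_star: "p (star x) = p x"
proof -
  have le: "p x \<le> p (star x)" for x
  proof (cases "p x = 0")
    case False
    then have "p x * p x \<le> p (star x) * p x"
      using cs_mult[of "star x" x] cs_star_mult[of x] by (simp add: power2_eq_square)
    then show ?thesis using False cs_nonneg[of x] by simp
  qed (simp add: cs_nonneg)
  show ?thesis using le[of x] le[of "star x"] by simp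
qed

lemma cs_square: "star x = x \<Longrightarrow> p (x * x) = (p x)\<^sup>2"
  using cs_star_mult[of x] by simp

text \<open>The value 0 does occur: the zero seminorm satisfies every clause and appears later as
  \<open>max_seminorm {}\<close>.\<close>

lemma cs_one: "p 1 = 0 \<or> p 1 = 1"
  using cs_star_mult[of 1] by (simp add: power2_eq_square)

lemma cs_one_le: "p 1 \<le> 1"
  using cs_one by auto

lemma cs_isometry_le: "star u * u = 1 \<Longrightarrow> p u \<le> 1"
  using cs_star_mult[of u] cs_one_le cs_nonneg[of u] by (simp add: power_le_one_iff)

text \<open>\<open>p (a + i g)\<close> dominates the seminorms of its real and imaginary parts.\<close>
lemma cs_parts_le:
  assumes "star a = a" "star g = g" "a * g = g * a"
  shows "(p a)\<^sup>2 \<le> p (a * a + g * g)" "(p g)\<^sup>2 \<le> p (a * a + g * g)"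
proof -
  define u where "u = a + smul \<i> g"
  have su: "star u = a - smul \<i> g" using assms by (simp add: u_def)
  have "star u * u = a * a + g * g"
    unfolding su unfolding u_def using assms(3) by (simp add: algebra_simps)
  then have pu: "(p u)\<^sup>2 = p (a * a + g * g)" using cs_star_mult[of u] by simp
  \<comment> \<open>The parts are recovered from 2 a = u + \<open>star u\<close> and 2 i g = u -
    \<open>star u\<close>, where both summands have the same seminorm.\<close>
  have "smul 2 a = u + star u" unfolding su by (simp add: u_def smul_two)
  then have "2 * p a \<le> p u + p u" using cs_triangle[of u "star u"] cs_star cs_smul[of 2 a] by simp
  moreover have "smul (2 * \<i>) g = u - star u"
    unfolding su using smul_two[of "smul \<i> g"] by (simp add: u_def)
  then have "2 * p g \<le> p u + p u"
    using cs_diff_le[of u "star u"] cs_star cs_smul[of "2 * \<i>" g] by (simp add: norm_mult)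
  ultimately show "(p a)\<^sup>2 \<le> p (a * a + g * g)" "(p g)\<^sup>2 \<le> p (a * a + g * g)"
    unfolding pu[symmetric] using cs_nonneg by (auto intro!: power_mono)
qed

end

end

text \<open>The iteration \<open>z \<mapsto> (w + z\<^sup>2) / 2\<close> converges to \<open>1 - sqrt (1 - w)\<close>; its iterates are polynomials
  in \<open>w\<close> with nonnegative coefficients, so they are dominated by the scalar iteration at \<open>w = 1\<close>.\<close>
primrec zeta :: "nat \<Rightarrow> real" where
  "zeta 0 = 0"
| "zeta (Suc n) = (1 + zeta n * zeta n) / 2"

lemma zeta_bounds: "0 \<le> zeta n \<and> zeta n \<le> 1"
proof (induction n)
  case (Suc n)
  then have "zeta n * zeta n \<le> 1" by (simp add: mult_le_one)
  with Suc show ?case by simp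
qed simp

lemma zeta_le_Suc: "zeta n \<le> zeta (Suc n)"
proof -
  have "0 \<le> (1 - zeta n) * (1 - zeta n)" by simp
  then show ?thesis by (simp add: algebra_simps)
qed

lemma zeta_mono: "n \<le> m \<Longrightarrow> zeta n \<le> zeta m"
  using zeta_le_Suc by (rule lift_Suc_mono_le)

lemma zeta_Cauchy: "Cauchy zeta"
proof -
  have "incseq zeta" using zeta_mono by (simp add: incseq_def)
  then have "convergent zeta"
    using zeta_bounds incseq_convergent[of zeta 1] by (metis convergent_def)
  then show ?thesis by (simp add: Cauchy_convergent_iff)
qed

lemma zeta_diff_small:
  assumes "e > 0" obtains N where "\<And>m n. N \<le> n \<Longrightarrow> n \<le> m \<Longrightarrow> zeta m - zeta n < e"
proof -
  obtain N where N: "\<And>m n. m \<ge> N \<Longrightarrow> n \<ge> N \<Longrightarrow> dist (zeta m) (zeta n) < e"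
    using zeta_Cauchy assms unfolding Cauchy_def by blast
  show ?thesis
  proof
    fix m n assume "N \<le> n" "n \<le> m"
    then show "zeta m - zeta n < e" using N[of m n] by (simp add: dist_real_def)
  qed
qed

context star_algebra
begin

primrec zit :: "'a \<Rightarrow> nat \<Rightarrow> 'a" where
  "zit w 0 = 0"
| "zit w (Suc n) = smul (1/2) (w + zit w n * zit w n)"

lemma zit_commute:
  assumes "x * w = w * x" shows "x * zit w n = zit w n * x"
proof (induction n)
  case (Suc n)
  then have "x * (zit w n * zit w n) = zit w n * zit w n * x" by (metis mult.assoc)
  then show ?case using assms by (simp add: distrib_left distrib_right)
qed simp

lemma star_zit: "star w = w \<Longrightarrow> star (zit w n) = zit w n"
  by (induction n) auto

lemma zit_le: 
  assumes "cs p" "p w \<le> 1" shows "p (zit w n) \<le> zeta n"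
proof (induction n)
  case (Suc n)
  have "p (zit w n * zit w n) \<le> zeta n * zeta n"
    using cs_mult[OF assms(1), of "zit w n" "zit w n"] mult_mono[OF Suc Suc] cs_nonneg[OF assms(1)]
      zeta_bounds[of n] by fastforce
  then show ?case
    using cs_triangle[OF assms(1), of w "zit w n * zit w n"] assms(2) by (simp add: cs_smul[OF assms(1)])
qed (simp add: cs_zero assms)

text \<open>With a^2 - b^2 = a (a - b) + (a - b) b, an identity that needs no commutation, each
  increment is bounded by the same expression in \<open>zeta\<close>. Thus the Cauchy property of
  \<open>zeta\<close> passes to \<open>zit w\<close> in every seminorm with p w \<le> 1.\<close>

lemma zit_diff_le:
  assumes p: "cs p" "p w \<le> 1" and "n \<le> m"
  shows "p (zit w m - zit w n) \<le> zeta m - zeta n"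
  using \<open>n \<le> m\<close>
proof (induction n arbitrary: m)
  case 0
  then show ?case using zit_le[OF p] by simp
next
  case (Suc n)
  then obtain l where m: "m = Suc l" "n \<le> l" by (cases m) auto
  let ?a = "zit w l" and ?b = "zit w n"
  note IH = Suc.IH[OF m(2)]
  have "p (?a * (?a - ?b)) \<le> zeta l * (zeta l - zeta n)"
    using cs_mult[OF p(1), of ?a "?a - ?b"] mult_mono[OF zit_le[OF p] IH, of l] 
      cs_nonneg[OF p(1)] zeta_bounds[of l] by fastforce
  moreover have "p ((?a - ?b) * ?b) \<le> (zeta l - zeta n) * zeta n"
    using cs_mult[OF p(1), of "?a - ?b" ?b] mult_mono[OF IH zit_le[OF p], of n] 
      cs_nonneg[OF p(1)] zeta_mono[OF m(2)] by fastforce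
  ultimately have "p (?a * (?a - ?b) + (?a - ?b) * ?b) \<le> zeta l * zeta l - zeta n * zeta n"
    using cs_triangle[OF p(1), of "?a * (?a - ?b)" "(?a - ?b) * ?b"] by (simp add: algebra_simps)
  moreover have "zit w m - zit w (Suc n) = smul (1/2) (?a * (?a - ?b) + (?a - ?b) * ?b)"
    by (simp add: m algebra_simps)
  ultimately show ?case by (simp only: m(1) zeta.simps cs_smul[OF p(1)]) (simp add: field_simps)
qed

text \<open>An exact error formula for the approximate square root 1 - \<open>zit w n\<close> of 1 -
  w. It makes a finite iterate usable for a single seminorm, before any completeness is
  assumed.\<close>

lemma zit_residual: "(1 - zit w n) * (1 - zit w n) - (1 - w) = smul 2 (zit w (Suc n) - zit w n)"
  by (simp add: scale_right_diff_distrib smul_two[of "zit w n"] algebra_simps)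

text \<open>If \<open>s\<close> is an approximate square root of \<open>1 - h\<^sup>2\<close>, then \<open>h + i s\<close> is almost unitary, so \<open>s\<close> is
  almost a contraction.\<close>
lemma cs_one_minus_square_le:
  assumes p: "cs p" and h: "star h = h" "p h \<le> 1"
  shows "p (1 - h * h) \<le> 1"
proof (rule field_le_epsilon)
  fix e :: real assume "e > 0"
  let ?w = "h * h"
  have w: "p ?w \<le> 1" using cs_square[OF p h(1)] h(2) cs_nonneg[OF p, of h] by (simp add: power_le_one)
  \<comment> \<open>The residual is twice an increment and enters twice, once in bounding s * s and
    once in replacing s * s by 1 - h * h; hence e / 4.\<close>
  obtain N where N: "\<And>m n. N \<le> n \<Longrightarrow> n \<le> m \<Longrightarrow> zeta m - zeta n < e / 4"
    using zeta_diff_small[of "e/4"] \<open>e > 0\<close> by auto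
  define s where "s = 1 - zit ?w N"
  have sh: "h * s = s * h" unfolding s_def
    using zit_commute[of h ?w N] by (simp add: algebra_simps mult.assoc)
  have ss: "star s = s" unfolding s_def using star_zit[of ?w N] h by simp
  have "p (zit ?w (Suc N) - zit ?w N) \<le> e / 4"
    using zit_diff_le[OF p w, of N "Suc N"] N[of N "Suc N"] by linarith
  then have r: "p (s * s - (1 - ?w)) \<le> e / 2"
    unfolding s_def zit_residual by (simp only: cs_smul[OF p]) simp
  have "p (h * h + s * s) \<le> p 1 + p (h * h + s * s - 1)" by (rule cs_le_add_diff[OF p])
  also have "h * h + s * s - 1 = s * s - (1 - ?w)" by simp
  finally have "p (h * h + s * s) \<le> 1 + e / 2" using r cs_one_le[OF p] by simp
  then have "p (s * s) \<le> 1 + e / 2"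
    using cs_parts_le(2)[OF p h(1) ss sh] cs_square[OF p ss] by simp
  moreover have "p (1 - ?w) \<le> p (s * s) + p (1 - ?w - s * s)" by (rule cs_le_add_diff[OF p])
  moreover have "p (1 - ?w - s * s) = p (s * s - (1 - ?w))" by (rule cs_diff_commute[OF p])
  ultimately show "p (1 - ?w) \<le> 1 + e" using r by simp
qed

text \<open>Rescale h by 1 / sqrt M. The excluded case M = 0 forces p (h * h) = 0. The result serves
  both the positivity of squares and the contraction estimate behind inverses.\<close>

lemma cs_const_minus_square_le:
  assumes p: "cs p" and h: "star h = h" "(p h)\<^sup>2 \<le> M"
  shows "p (smul (of_real M) 1 - h * h) \<le> M"
proof (cases "M = 0")
  case True
  then have "p (h * h) = 0" using cs_square[OF p h(1)] h(2) by simp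
  then show ?thesis using True cs_minus[OF p, of "h * h"] by simp
next
  case False
  then have M: "M > 0" using h(2) by (smt (verit) zero_le_power2)
  define c where "c = 1 / sqrt M"
  have c: "c > 0" "c * c = 1 / M" using M by (auto simp: c_def)
  have "p h \<le> sqrt M" using h(2) by (rule real_le_rsqrt)
  then have "p (smul (of_real c) h) \<le> 1"
    using M by (simp add: cs_smul[OF p] norm_divide c_def)
  then have "p (1 - smul (of_real c) h * smul (of_real c) h) \<le> 1"
    using cs_one_minus_square_le[OF p, of "smul (of_real c) h"] h(1) by simp
  moreover have "smul (of_real M) 1 - h * h = smul (of_real M) (1 - smul (of_real c) h * smul (of_real c) h)"
    using c M by (simp add: scale_right_diff_distrib flip: of_real_mult)
  ultimately show ?thesis using M by (simp add: cs_smul[OF p])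
qed

end

subsection \<open>Square roots, inverses and positivity\<close>

text \<open>No topology is mentioned: \<open>Q\<close> will be the family of maxima of finitely many
  given seminorms, so a ball of one member of \<open>Q\<close> is already a basic
  neighbourhood.\<close>

locale lcs_algebra = star_algebra smul star
  for smul :: "complex \<Rightarrow> 'a::ring_1 \<Rightarrow> 'a" and star :: "'a \<Rightarrow> 'a" +
  fixes Q :: "('a \<Rightarrow> real) set"
  assumes Q_cs: "q \<in> Q \<Longrightarrow> cs q"
    and Q_separating: "(\<And>q. q \<in> Q \<Longrightarrow> q x = 0) \<Longrightarrow> x = 0"
    and Q_complete: "sn_complete Q"
begin

lemmas Q_triangle = cs_triangle[OF Q_cs] and Q_smul = cs_smul[OF Q_cs] and Q_mult = cs_mult[OF Q_cs]
  and Q_zero = cs_zero[OF Q_cs] and Q_nonneg = cs_nonneg[OF Q_cs]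
  and Q_star = cs_star[OF Q_cs] and Q_square = cs_square[OF Q_cs]

lemma star_mult_eq_zero: "star x * x = 0 \<Longrightarrow> x = 0"
proof (rule Q_separating)
  fix q assume x: "star x * x = 0" and q: "q \<in> Q"
  have "(q x)\<^sup>2 = 0" using cs_star_mult[OF Q_cs[OF q], of x] Q_zero[OF q] x by simp
  then show "q x = 0" by simp
qed

lemma square_eq_zero: "star x = x \<Longrightarrow> x * x = 0 \<Longrightarrow> x = 0"
  using star_mult_eq_zero[of x] by simp

section \<open>Convergence of sequences with respect to all seminorms in \<open>Q\<close>\<close>

definition conv :: "(nat \<Rightarrow> 'a) \<Rightarrow> 'a \<Rightarrow> bool" where
  "conv X a \<longleftrightarrow> (\<forall>q\<in>Q. (\<lambda>n. q (X n - a)) \<longlonglongrightarrow> 0)"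

lemma convI:
  assumes "\<And>q. q \<in> Q \<Longrightarrow> g q \<longlonglongrightarrow> 0" "\<And>q n. q \<in> Q \<Longrightarrow> q (X n - a) \<le> g q n"
  shows "conv X a"
  unfolding conv_def
proof
  fix q assume q: "q \<in> Q"
  show "(\<lambda>n. q (X n - a)) \<longlonglongrightarrow> 0"
    by (rule tendsto_sandwich[OF _ _ tendsto_const assms(1)[OF q]])
      (auto simp: Q_nonneg[OF q] assms(2)[OF q])
qed

lemma conv_const: "conv (\<lambda>n. a) a"
  by (simp add: conv_def Q_zero)

lemma conv_add: 
  assumes "conv X a" "conv Y b" shows "conv (\<lambda>n. X n + Y n) (a + b)"
proof (rule convI)
  fix q assume q: "q \<in> Q"
  show "(\<lambda>n. q (X n - a) + q (Y n - b)) \<longlonglongrightarrow> 0"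
    using assms q tendsto_add[of "\<lambda>n. q (X n - a)" 0 _ "\<lambda>n. q (Y n - b)" 0] by (auto simp: conv_def)
  show "q (X n + Y n - (a + b)) \<le> q (X n - a) + q (Y n - b)" for n
    using Q_triangle[OF q, of "X n - a" "Y n - b"] by (simp add: algebra_simps)
qed

lemma conv_smul: 
  assumes "conv X a" shows "conv (\<lambda>n. smul c (X n)) (smul c a)"
proof (rule convI)
  fix q assume q: "q \<in> Q"
  show "(\<lambda>n. cmod c * q (X n - a)) \<longlonglongrightarrow> 0"
    using assms q tendsto_mult_right_zero[of "\<lambda>n. q (X n - a)"] by (auto simp: conv_def)
  show "q (smul c (X n) - smul c a) \<le> cmod c * q (X n - a)" for n
    by (simp add: Q_smul[OF q] flip: scale_right_diff_distrib)
qed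

lemma conv_diff: "conv X a \<Longrightarrow> conv Y b \<Longrightarrow> conv (\<lambda>n. X n - Y n) (a - b)"
  using conv_add[of X a "\<lambda>n. smul (-1) (Y n)" "smul (-1) b"] conv_smul[of Y b "-1"] by simp

lemma conv_mult: 
  assumes "conv X a" "conv Y b" shows "conv (\<lambda>n. X n * Y n) (a * b)"
proof (rule convI)
  fix q assume q: "q \<in> Q"
  let ?x = "\<lambda>n. q (X n - a)" and ?y = "\<lambda>n. q (Y n - b)"
  have "?x \<longlonglongrightarrow> 0" "?y \<longlonglongrightarrow> 0" using assms q by (auto simp: conv_def)
  then have "(\<lambda>n. ?x n * ?y n + ?x n * q b + q a * ?y n) \<longlonglongrightarrow> 0 * 0 + 0 * q b + q a * 0"
    by (intro tendsto_intros)
  then show "(\<lambda>n. ?x n * ?y n + ?x n * q b + q a * ?y n) \<longlonglongrightarrow> 0" by simp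
  fix n
  have eq: "X n * Y n - a * b = (X n - a) * (Y n - b) + (X n - a) * b + a * (Y n - b)"
    by (simp add: algebra_simps)
  show "q (X n * Y n - a * b) \<le> ?x n * ?y n + ?x n * q b + q a * ?y n"
    unfolding eq using Q_triangle[OF q, of "(X n - a) * (Y n - b) + (X n - a) * b" "a * (Y n - b)"]
      Q_triangle[OF q, of "(X n - a) * (Y n - b)" "(X n - a) * b"] 
      Q_mult[OF q, of "X n - a" "Y n - b"] Q_mult[OF q, of "X n - a" b] Q_mult[OF q, of a "Y n - b"] 
    by linarith
qed

lemma conv_star: "conv X a \<Longrightarrow> conv (\<lambda>n. star (X n)) (star a)"
  unfolding conv_def by (simp add: Q_star flip: star_diff)

lemma conv_unique: 
  assumes "conv X a" "conv X b" shows "a = b"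
proof -
  have "a - b = 0"
  proof (rule Q_separating)
    fix q assume q: "q \<in> Q"
    have "(\<lambda>n. q (X n - a) + q (X n - b)) \<longlonglongrightarrow> 0"
      using assms q tendsto_add[of "\<lambda>n. q (X n - a)" 0 _ "\<lambda>n. q (X n - b)" 0] by (auto simp: conv_def)
    moreover have "q (a - b) \<le> q (X n - a) + q (X n - b)" for n
      using cs_diff_triangle[OF Q_cs[OF q], of a b "X n"] cs_diff_commute[OF Q_cs[OF q], of a "X n"]
      by simp
    ultimately have "q (a - b) \<le> 0" by (intro LIMSEQ_le_const) auto
    then show "q (a - b) = 0" using Q_nonneg[OF q, of "a - b"] by simp
  qed
  then show ?thesis by simp
qed

lemma conv_Suc: "conv X a \<Longrightarrow> conv (\<lambda>n. X (Suc n)) a"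
  unfolding conv_def by (auto intro: LIMSEQ_Suc)

lemma conv_le:
  assumes "conv X a" "q \<in> Q" "\<And>n. q (X n) \<le> C" shows "q a \<le> C"
proof -
  have "(\<lambda>n. C + q (X n - a)) \<longlonglongrightarrow> C + 0"
    using assms by (intro tendsto_intros) (auto simp: conv_def)
  moreover have "q a \<le> C + q (X n - a)" for n
    using cs_le_add_diff[OF Q_cs[OF assms(2)], of a "X n"] assms(3)[of n]
      cs_diff_commute[OF Q_cs[OF assms(2)], of a "X n"] by simp
  ultimately have "q a \<le> C + 0" by (intro LIMSEQ_le_const) auto
  then show ?thesis by simp
qed

lemma conv_commute:
  assumes "conv X a" "\<And>n. x * X n = X n * x" shows "x * a = a * x"
  using conv_unique[OF conv_mult[OF conv_const assms(1), of x]] 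
    conv_mult[OF assms(1) conv_const, of x] assms(2) by simp

text \<open>Completeness is formulated with filters; a sequence enters as
  \<open>filtermap X sequentially\<close>.\<close>

lemma Cauchy_conv:
  assumes "\<And>q e. q \<in> Q \<Longrightarrow> e > 0 \<Longrightarrow> \<exists>N. \<forall>n m. N \<le> n \<and> n \<le> m \<longrightarrow> q (X m - X n) < e"
  obtains a where "conv X a"
proof -
  let ?F = "filtermap X sequentially"
  have "sn_cauchy Q ?F"
    unfolding sn_cauchy_def
  proof (intro conjI ballI allI impI)
    show "?F \<noteq> bot" by (simp add: filtermap_bot_iff)
    fix q e assume q: "q \<in> Q" and "(0::real) < e"
    then obtain N where N: "\<And>n m. N \<le> n \<Longrightarrow> n \<le> m \<Longrightarrow> q (X m - X n) < e"
      using assms by meson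
    have N2: "q (X m - X n) < e" if "N \<le> n" "N \<le> m" for n m
      using N[of n m] N[of m n] that cs_diff_commute[OF Q_cs[OF q], of "X n" "X m"] 
      by (cases "n \<le> m") auto
    have "eventually (\<lambda>v. \<exists>n\<ge>N. v = X n) ?F"
      by (auto simp: eventually_filtermap eventually_sequentially)
    then show "\<forall>\<^sub>F (x, y) in ?F \<times>\<^sub>F ?F. q (x - y) < e"
      unfolding eventually_prod_same using N2 by (intro exI[of _ "\<lambda>v. \<exists>n\<ge>N. v = X n"]) auto
  qed
  then obtain a where a: "sn_converges Q ?F a" using Q_complete unfolding sn_complete_def by blast
  have "conv X a"
    unfolding conv_def
  proof
    fix q assume q: "q \<in> Q"
    show "(\<lambda>n. q (X n - a)) \<longlonglongrightarrow> 0"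
      unfolding tendsto_iff using a q Q_nonneg[OF q]
      by (auto simp: sn_converges_def eventually_filtermap dist_real_def)
  qed
  then show ?thesis using that by blast
qed

text \<open>The bound q w \<le> 1 holds for all q in \<open>Q\<close>, so \<open>zeta\<close>
  dominates the iteration in every seminorm and completeness gives a limit z. Self-adjointness, the
  bound and commutation pass to the limit.\<close>

lemma sqrt_exists:
  assumes "\<And>q. q \<in> Q \<Longrightarrow> q w \<le> 1" "star w = w"
  obtains z where "(1 - z) * (1 - z) = 1 - w" "star z = z" "\<And>q. q \<in> Q \<Longrightarrow> q z \<le> 1"
    "\<And>x. x * w = w * x \<Longrightarrow> x * z = z * x"
proof -
  have "\<exists>N. \<forall>n m. N \<le> n \<and> n \<le> m \<longrightarrow> q (zit w m - zit w n) < e" if q: "q \<in> Q" and "e > 0" for q e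
  proof -
    obtain N where N: "\<And>m n. N \<le> n \<Longrightarrow> n \<le> m \<Longrightarrow> zeta m - zeta n < e"
      using zeta_diff_small \<open>e > 0\<close> by blast
    have "q (zit w m - zit w n) < e" if "N \<le> n" "n \<le> m" for m n
      using N[OF that] zit_diff_le[OF Q_cs[OF q] assms(1)[OF q] that(2)] by linarith
    then show ?thesis by blast
  qed
  then obtain z where z: "conv (zit w) z" using Cauchy_conv[of "zit w"] by meson
  have "conv (\<lambda>n. zit w (Suc n)) (smul (1/2) (w + z * z))"
    unfolding zit.simps by (intro conv_smul conv_add conv_const conv_mult z)
  \<comment> \<open>The limit is a fixed point of the iteration; 2 z = w + z^2 is the same as (1 -
    z)^2 = 1 - w.\<close>
  then have "z = smul (1/2) (w + z * z)" using conv_Suc[OF z] conv_unique by blast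
  then have "smul 2 z = smul 2 (smul (1/2) (w + z * z))" by simp
  then have "smul 2 z = w + z * z" by (simp del: scale_cancel_left)
  then have "(1 - z) * (1 - z) = 1 - w" by (simp add: smul_two algebra_simps)
  moreover have "conv (zit w) (star z)" using conv_star[OF z] by (simp only: star_zit[OF assms(2)])
  then have "star z = z" using z by (rule conv_unique)
  moreover have "q z \<le> 1" if q: "q \<in> Q" for q
  proof (rule conv_le[OF z q])
    show "q (zit w n) \<le> 1" for n
      using zit_le[OF Q_cs[OF q] assms(1)[OF q], of n] zeta_bounds[of n] by linarith
  qed
  moreover have "x * z = z * x" if "x * w = w * x" for x
    by (rule conv_commute[OF z]) (rule zit_commute[OF that])
  ultimately show ?thesis using that by blast
qed

text \<open>The bound is uniform over \<open>Q\<close>. In general the values q x of an element need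
  not be bounded, and the square root iteration is only run where they are.\<close>

definition bounded_elt :: "'a \<Rightarrow> bool" where
  "bounded_elt x \<longleftrightarrow> (\<exists>C>0. \<forall>q\<in>Q. q x \<le> C)"

lemma bounded_eltI: "(\<And>q. q \<in> Q \<Longrightarrow> q x \<le> C) \<Longrightarrow> bounded_elt x"
  unfolding bounded_elt_def by (rule exI[of _ "max C 1"]) (auto simp: le_max_iff_disj)

lemma bounded_mult: 
  assumes "bounded_elt x" "bounded_elt y" shows "bounded_elt (x * y)"
proof -
  obtain C D where "C > 0" "\<And>q. q \<in> Q \<Longrightarrow> q x \<le> C" "D > 0" "\<And>q. q \<in> Q \<Longrightarrow> q y \<le> D"
    using assms unfolding bounded_elt_def by metis
  then have "q (x * y) \<le> C * D" if "q \<in> Q" for q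
    using Q_mult[OF that, of x y] mult_mono[of "q x" C "q y" D] Q_nonneg[OF that] that by force
  then show ?thesis by (rule bounded_eltI)
qed

lemma bounded_smul: 
  assumes "bounded_elt x" shows "bounded_elt (smul c x)"
proof -
  obtain C where "\<And>q. q \<in> Q \<Longrightarrow> q x \<le> C" using assms unfolding bounded_elt_def by metis
  then show ?thesis by (intro bounded_eltI[of _ "cmod c * C"]) (simp add: Q_smul mult_left_mono)
qed

text \<open>Positivity without a spectrum: for self-adjoint x in a C*-algebra, norm (C - x) \<le> C
  says that the spectrum lies in [0, 2 C]. A single C for all q makes x bounded as well.\<close>

definition Pos :: "'a \<Rightarrow> bool" where
  "Pos x \<longleftrightarrow> star x = x \<and> (\<exists>C>0. \<forall>q\<in>Q. q (smul (of_real C) 1 - x) \<le> C)"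

lemma PosI: "star x = x \<Longrightarrow> 0 < C \<Longrightarrow> (\<And>q. q \<in> Q \<Longrightarrow> q (smul (of_real C) 1 - x) \<le> C) \<Longrightarrow> Pos x"
  unfolding Pos_def by blast

text \<open>For w = 1 - x / C one has q w \<le> 1, so \<open>sqrt_exists\<close> provides a root of
  1 - w = x / C, which is rescaled by sqrt C.\<close>

lemma Pos_sqrt:
  assumes "Pos x"
  obtains r where "r * r = x" "star r = r" "bounded_elt r" "\<And>y. y * x = x * y \<Longrightarrow> y * r = r * y"
proof -
  obtain C where C: "C > 0" "\<And>q. q \<in> Q \<Longrightarrow> q (smul (of_real C) 1 - x) \<le> C" and x: "star x = x"
    using assms unfolding Pos_def by blast
  define w where "w = 1 - smul (of_real (1/C)) x"
  have w: "w = smul (of_real (1/C)) (smul (of_real C) 1 - x)"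
    using C(1) by (simp add: w_def scale_right_diff_distrib)
  have "q w \<le> 1" if "q \<in> Q" for q
    using C that by (simp add: w Q_smul norm_divide)
  moreover have "star w = w" using x by (simp add: w_def)
  ultimately obtain z where z: "(1 - z) * (1 - z) = 1 - w" "star z = z" "\<And>q. q \<in> Q \<Longrightarrow> q z \<le> 1"
    "\<And>y. y * w = w * y \<Longrightarrow> y * z = z * y"
    using sqrt_exists by blast
  let ?r = "smul (of_real (sqrt C)) (1 - z)"
  show ?thesis
  proof
    have "smul (of_real (sqrt C) * of_real (sqrt C)) ((1 - z) * (1 - z)) = x"
      using C(1) unfolding z(1) w_def by (simp flip: of_real_mult)
    then show "?r * ?r = x" by simp
    show "star ?r = ?r" using z(2) by simp
    have "bounded_elt (1 - z)"
    proof (rule bounded_eltI[of _ 2])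
      fix q assume q: "q \<in> Q"
      show "q (1 - z) \<le> 2"
        using cs_diff_le[OF Q_cs[OF q], of 1 z] cs_one_le[OF Q_cs[OF q]] z(3)[OF q] by linarith
    qed
    then show "bounded_elt ?r" by (rule bounded_smul)
    show "y * ?r = ?r * y" if "y * x = x * y" for y
    proof -
      have "y * w = w * y" using that by (simp add: w_def algebra_simps)
      then show ?thesis using z(4) by (simp add: algebra_simps)
    qed
  qed
qed

lemma Pos_square:
  assumes "star h = h" "bounded_elt h" shows "Pos (h * h)"
proof -
  obtain C where C: "C > 0" "\<And>q. q \<in> Q \<Longrightarrow> q h \<le> C" using assms unfolding bounded_elt_def by blast
  have "q (smul (of_real (C\<^sup>2)) 1 - h * h) \<le> C\<^sup>2" if "q \<in> Q" for q
    using C(2)[OF that] Q_nonneg[OF that, of h] 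
    by (intro cs_const_minus_square_le[OF Q_cs[OF that] assms(1)] power_mono) auto
  then show ?thesis using C(1) assms(1) by (intro PosI[of _ "C\<^sup>2"]) auto
qed

text \<open>Each root commutes with everything that commutes with its square, so the roots r and s
  commute and x y = (r s)^2 is the square of a bounded self-adjoint element.\<close>

lemma Pos_mult:
  assumes "Pos x" "Pos y" "x * y = y * x" shows "Pos (x * y)"
proof -
  obtain r where r: "r * r = x" "star r = r" "bounded_elt r" "\<And>u. u * x = x * u \<Longrightarrow> u * r = r * u"
    using Pos_sqrt[OF assms(1)] by blast
  obtain s where s: "s * s = y" "star s = s" "bounded_elt s" "\<And>u. u * y = y * u \<Longrightarrow> u * s = s * u"
    using Pos_sqrt[OF assms(2)] by blast
  have "y * r = r * y" using r(4) assms(3) by simp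
  then have rs: "r * s = s * r" using s(4) by simp
  have "x * y = r * (r * s) * s" using r(1) s(1) by (metis mult.assoc)
  also have "\<dots> = r * (s * r) * s" by (simp only: rs)
  finally have "x * y = (r * s) * (r * s)" by (simp add: mult.assoc)
  moreover have "star (r * s) = r * s" using r(2) s(2) rs by simp
  ultimately show ?thesis using Pos_square[OF _ bounded_mult[OF r(3) s(3)]] by simp
qed

text \<open>Take commuting roots r of x and s of -x. Then r^2 + s^2 = 0, and
  \<open>cs_parts_le\<close> gives q r = 0 for all q.\<close>

lemma Pos_antisym:
  assumes "Pos x" "Pos (- x)" shows "x = 0"
proof -
  obtain r where r: "r * r = x" "star r = r" "\<And>u. u * x = x * u \<Longrightarrow> u * r = r * u"
    using Pos_sqrt[OF assms(1)] by blast
  obtain s where s: "s * s = - x" "star s = s" "\<And>u. u * (- x) = (- x) * u \<Longrightarrow> u * s = s * u"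
    using Pos_sqrt[OF assms(2)] by blast
  have "x * r = r * x" using r(1) by (metis mult.assoc)
  then have "r * s = s * r" using s(3)[of r] by simp
  then have "(q r)\<^sup>2 \<le> 0" if "q \<in> Q" for q
    using cs_parts_le(1)[OF Q_cs[OF that] r(2) s(2)] r(1) s(1) Q_zero[OF that] by simp
  then have "r = 0" by (intro Q_separating) simp
  then show ?thesis using r(1) by simp
qed

text \<open>Successive approximation with the step sizes \<open>1 / real (n + 2)\<close>, which tend to 0 (so that the step is
  eventually a contraction for every seminorm) but have a divergent sum.\<close>
primrec inv_res :: "'a \<Rightarrow> nat \<Rightarrow> 'a" where
  "inv_res a 0 = 1"
| "inv_res a (Suc n) = inv_res a n - smul (of_real (1 / real (n + 2))) (a * inv_res a n)"

primrec inv_app :: "'a \<Rightarrow> nat \<Rightarrow> 'a" where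
  "inv_app a 0 = 0"
| "inv_app a (Suc n) = inv_app a n + smul (of_real (1 / real (n + 2))) (inv_res a n)"

lemma inv_res_eq: "inv_res a n = 1 - a * inv_app a n"
  by (induction n) (simp_all add: algebra_simps)

lemma inv_commute:
  assumes "x * a = a * x"
  shows "x * inv_res a n = inv_res a n * x" "x * inv_app a n = inv_app a n * x"
proof -
  show res: "x * inv_res a n = inv_res a n * x" for n
  proof (induction n)
    case (Suc n)
    have "x * (a * inv_res a n) = a * inv_res a n * x" using assms Suc by (metis mult.assoc)
    then show ?case using Suc by (simp add: left_diff_distrib right_diff_distrib)
  qed simp
  show "x * inv_app a n = inv_app a n * x"
    by (induction n) (simp_all add: distrib_left distrib_right res)
qed

text \<open>The recursion reads (n + 2) r(n+1) = ((n + 1) - h^2) r(n). Once (q h)^2 \<le> n + 1 the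
  factor has seminorm at most n + 1, so (n + 1) q (r(n)) no longer increases. The threshold depends
  on q, which is why h may be unbounded.\<close>

lemma inv_res_decay:
  assumes "star h = h" and q: "q \<in> Q"
  obtains N K where "\<And>n. N \<le> n \<Longrightarrow> (real n + 1) * q (inv_res (1 + h * h) n) \<le> K" "0 \<le> K"
proof -
  obtain N where N: "(q h)\<^sup>2 \<le> real N" using real_arch_simple by blast
  let ?r = "inv_res (1 + h * h)"
  have decay: "(real (Suc n) + 1) * q (?r (Suc n)) \<le> (real n + 1) * q (?r n)" if "N \<le> n" for n
  proof -
    have "(q h)\<^sup>2 \<le> real n + 1" using N that by simp
    then have "q (smul (of_real (real n + 1)) 1 - h * h) \<le> real n + 1"
      by (rule cs_const_minus_square_le[OF Q_cs[OF q] assms(1)])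
    then have "q ((smul (of_real (real n + 1)) 1 - h * h) * ?r n) \<le> (real n + 1) * q (?r n)"
      using Q_mult[OF q, of "smul (of_real (real n + 1)) 1 - h * h" "?r n"] Q_nonneg[OF q, of "?r n"]
        mult_right_mono by fastforce
    moreover have "smul (of_real (real n + 2)) (?r (Suc n)) = (smul (of_real (real n + 1)) 1 - h * h) * ?r n"
    proof -
      have "smul (of_real (real n + 2)) (?r (Suc n))
        = smul (of_real (real n + 2)) (?r n) - smul (of_real (real n + 2) * of_real (1 / real (n + 2))) ((1 + h * h) * ?r n)"
        by (simp only: inv_res.simps scale_right_diff_distrib scale_scale)
      also have "of_real (real n + 2) * of_real (1 / real (n + 2)) = (1 :: complex)"
        unfolding of_real_mult[symmetric] of_real_eq_1_iff by (simp add: field_simps)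
      also have "smul (of_real (real n + 2)) (?r n) = smul (of_real (real n + 1)) (?r n) + ?r n"
        using scale_left_distrib[of "of_real (real n + 1)" 1 "?r n"] by (simp add: add.assoc)
      finally show ?thesis by (simp add: left_diff_distrib distrib_right)
    qed
    ultimately have "q (smul (of_real (real n + 2)) (?r (Suc n))) \<le> (real n + 1) * q (?r n)" by simp
    then show ?thesis unfolding Q_smul[OF q] norm_of_real by (simp add: add.commute del: inv_res.simps)
  qed
  show ?thesis
  proof
    show "(real n + 1) * q (?r n) \<le> (real N + 1) * q (?r N)" if "N \<le> n" for n
      using that
    proof (induction n rule: dec_induct)
      case (step m)
      then show ?case using decay[of m] by linarith
    qed simp
    show "0 \<le> (real N + 1) * q (?r N)" using Q_nonneg[OF q] by simp
  qed
qed

lemma inverse_exists: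
  assumes h: "star h = h"
  obtains y where "(1 + h * h) * y = 1" "star y = y" "\<And>x. x * h = h * x \<Longrightarrow> x * y = y * x"
proof -
  let ?a = "1 + h * h"
  let ?r = "inv_res ?a" and ?y = "inv_app ?a"
  have "\<exists>N. \<forall>n m. N \<le> n \<and> n \<le> m \<longrightarrow> q (?y m - ?y n) < e" if q: "q \<in> Q" and e: "e > 0" for q e
  proof -
    obtain N K where K: "\<And>n. N \<le> n \<Longrightarrow> (real n + 1) * q (?r n) \<le> K" "0 \<le> K"
      using inv_res_decay[OF h q] by blast
    \<comment> \<open>The increments are at most K / ((n + 1) (n + 2)), which telescopes.\<close>
    have diff: "q (?y m - ?y n) \<le> K / (real n + 1) - K / (real m + 1)" if "N \<le> n" "n \<le> m" for m n
      using that(2)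
    proof (induction m rule: dec_induct)
      case base
      then show ?case by (simp add: Q_zero[OF q])
    next
      case (step m)
      have "q (?y (Suc m) - ?y n) \<le> q (?y m - ?y n) + q (smul (of_real (1 / real (m + 2))) (?r m))"
        using Q_triangle[OF q, of "?y m - ?y n" "smul (of_real (1 / real (m + 2))) (?r m)"] 
        by (simp add: algebra_simps)
      also have "q (smul (of_real (1 / real (m + 2))) (?r m)) = 1 / real (m + 2) * q (?r m)"
        unfolding Q_smul[OF q] norm_of_real by simp
      also have "q (?r m) \<le> K / (real m + 1)"
        using K(1)[of m] step that by (simp add: field_simps)
      then have "1 / real (m + 2) * q (?r m) \<le> 1 / real (m + 2) * (K / (real m + 1))" 
        by (intro mult_left_mono) auto
      also have "\<dots> = K / (real m + 1) - K / (real (Suc m) + 1)" by (simp add: field_simps)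
      finally show ?case using step.IH by simp
    qed
    obtain M where M: "K / e < real M" using reals_Archimedean2 by blast
    have "q (?y m - ?y n) < e" if "max N M \<le> n" "n \<le> m" for m n
    proof -
      have "K < e * real M" using M e by (simp add: field_simps)
      also have "\<dots> \<le> e * (real n + 1)" using that e by simp
      finally have "K / (real n + 1) < e" by (simp add: field_simps)
      moreover have "0 \<le> K / (real m + 1)" using K(2) by simp
      ultimately show ?thesis using diff[of n m] that by simp
    qed
    then show ?thesis by blast
  qed
  then obtain y where y: "conv ?y y" using Cauchy_conv[of ?y] by meson
  have "conv (\<lambda>n. 1 - ?a * ?y n) (1 - ?a * y)" by (intro conv_diff conv_mult conv_const y)
  moreover have "conv (\<lambda>n. 1 - ?a * ?y n) 0"
    unfolding conv_def inv_res_eq[symmetric] 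
  proof
    fix q assume q: "q \<in> Q"
    obtain N K where K: "\<And>n. N \<le> n \<Longrightarrow> (real n + 1) * q (?r n) \<le> K" 
      using inv_res_decay[OF h q] by blast
    show "(\<lambda>n. q (?r n - 0)) \<longlonglongrightarrow> 0"
    proof (rule tendsto_sandwich)
      show "(\<lambda>n. 0 :: real) \<longlonglongrightarrow> 0" by simp
      show "(\<lambda>n. K * (1 / (real n + 1))) \<longlonglongrightarrow> 0"
        using LIMSEQ_inverse_real_of_nat by (intro tendsto_mult_right_zero) (simp add: field_simps)
      show "\<forall>\<^sub>F n in sequentially. 0 \<le> q (?r n - 0)" by (simp add: Q_nonneg[OF q])
      show "\<forall>\<^sub>F n in sequentially. q (?r n - 0) \<le> K * (1 / (real n + 1))"
        using K by (auto simp: eventually_sequentially field_simps)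
    qed
  qed
  ultimately have "1 - ?a * y = 0" by (rule conv_unique)
  then have 1: "?a * y = 1" by simp
  have comm: "x * y = y * x" if "x * h = h * x" for x
  proof (rule conv_commute[OF y], rule inv_commute)
    have "x * (h * h) = h * h * x" using that by (metis mult.assoc)
    then show "x * (1 + h * h) = (1 + h * h) * x" by (simp add: distrib_left distrib_right)
  qed
  have "star y * ?a = 1" using arg_cong[OF 1, of star] h by simp
  then have "star y = y" using 1 by (metis mult.assoc mult_1_left mult_1_right)
  then show ?thesis using that 1 comm by blast
qed

text \<open>Replaces a possibly unbounded self-adjoint h by the bounded h (1 + h^2)^(-1). The new
  element stays in every right ideal that contains h and vanishes only if h does.\<close>

lemma bounded_transform:
  assumes h: "star h = h"
  obtains y where "(1 + h * h) * y = 1" "star y = y" "\<And>x. x * h = h * x \<Longrightarrow> x * y = y * x"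
    "star (h * y) = h * y" "bounded_elt (h * y)" "h * y = 0 \<Longrightarrow> h = 0"
proof -
  obtain y where y: "(1 + h * h) * y = 1" "star y = y" "\<And>x. x * h = h * x \<Longrightarrow> x * y = y * x"
    using inverse_exists[OF h] by blast
  have hy: "h * y = y * h" using y(3) by simp
  define k where "k = h * y"
  have sk: "star k = k" using h y(2) hy by (simp add: k_def)
  have yk: "y * k = k * y" unfolding k_def hy by (metis hy mult.assoc)
  have hyy: "h * h * y = 1 - y" using y(1) by (simp add: distrib_right eq_diff_eq add.commute)
  have "k * k = y * (h * h * y)" unfolding k_def by (metis hy mult.assoc)
  then have kk: "k * k = y - y * y" unfolding hyy by (simp add: right_diff_distrib)
  \<comment> \<open>The Cayley transform of \<open>h\<close>, up to sign.\<close>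
  define u where "u = (y + y - 1) + smul (2 * \<i>) k"
  have su: "star u = (y + y - 1) - smul (2 * \<i>) k" using y(2) sk by (simp add: u_def)
  \<comment> \<open>Here u is an isometry because (2 y - 1)^2 + 4 k^2 = 1, by k^2 = y - y^2. The
    bound on k then comes from 4 i k = u - \<open>star u\<close>.\<close>
  have "star u * u = (y + y - 1) * (y + y - 1) + smul 4 (k * k)"
    unfolding su unfolding u_def by (simp add: algebra_simps yk)
  also have "\<dots> = 1"
  proof -
    have "smul 4 x = x + x + x + x" for x
      using scale_left_distrib[of 2 2 x] by (simp add: smul_two algebra_simps)
    then show ?thesis unfolding kk by (simp add: algebra_simps)
  qed
  finally have uu: "star u * u = 1" .
  have "q k \<le> 1" if q: "q \<in> Q" for q
  proof -
    have "smul (4 * \<i>) k = u - star u"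
      unfolding su using smul_two[of "smul (2 * \<i>) k"] by (simp add: u_def)
    then have "4 * q k \<le> q u + q (star u)"
      using cs_diff_le[OF Q_cs[OF q], of u "star u"] Q_smul[OF q, of "4 * \<i>" k] by (simp add: norm_mult)
    then show ?thesis using cs_isometry_le[OF Q_cs[OF q] uu] Q_star[OF q, of u] by simp
  qed
  then have b: "bounded_elt (h * y)" unfolding k_def by (rule bounded_eltI)
  have "h = 0" if "h * y = 0"
  proof -
    have "h = h * ((1 + h * h) * y)" using y(1) by simp
    also have "\<dots> = (h + h * h * h) * y" by (simp add: algebra_simps)
    also have "\<dots> = h * y + h * h * (h * y)" by (simp add: algebra_simps)
    finally show ?thesis using that by simp
  qed
  then show ?thesis using that y sk b unfolding k_def by blast
qed

subsection \<open>Minimal projections\<close>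

definition minproj :: "'a \<Rightarrow> bool" where
  "minproj e \<longleftrightarrow> star e = e \<and> e * e = e \<and> e \<noteq> 0 \<and> (\<forall>a. \<exists>c. e * a * e = smul c e)"

text \<open>The situation behind every maximal closed left ideal \<open>M\<close> of an annihilator algebra: all nonzero
  self-adjoint elements of \<open>R = ran M\<close> have the same left annihilator \<open>M\<close>.\<close>
context
  fixes M R :: "'a set"
  assumes R_mult: "\<And>x a. x \<in> R \<Longrightarrow> x * a \<in> R"
    and R_add: "\<And>x y. x \<in> R \<Longrightarrow> y \<in> R \<Longrightarrow> x + y \<in> R"
    and R_smul: "\<And>x c. x \<in> R \<Longrightarrow> smul c x \<in> R"
    and R_lan: "\<And>x a. x \<in> R \<Longrightarrow> star x = x \<Longrightarrow> x \<noteq> 0 \<Longrightarrow> a * x = 0 \<longleftrightarrow> a \<in> M"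
    and R_ran: "\<And>x. x \<in> R \<longleftrightarrow> (\<forall>a\<in>M. a * x = 0)"
begin

text \<open>If y is nonzero, x * y = 0 puts x into M; if x is nonzero too, the criterion applied to
  x itself turns this into x * x = 0.\<close>

lemma R_zero_divisor:
  assumes "x \<in> R" "y \<in> R" "star x = x" "star y = y" "x * y = 0"
  shows "x = 0 \<or> y = 0"
  using assms R_lan[of y x] R_lan[of x x] square_eq_zero[of x] by blast

text \<open>The alternatives are the \<open>Pos\<close> inequality with C = 1 for x and for -x. Let
  a be the square root of x^2. It lies in R, because m a (m a)^* = m x^2 m^* = 0 for m in M, and (a
  - x) (a + x) = 0 leaves only x = a or x = -a.\<close>

lemma R_abs:
  assumes x: "x \<in> R" "star x = x" and b: "\<And>q. q \<in> Q \<Longrightarrow> q x \<le> 1"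
  shows "(\<forall>q\<in>Q. q (1 - x) \<le> 1) \<or> (\<forall>q\<in>Q. q (1 + x) \<le> 1)"
proof -
  have "q (1 - x * x) \<le> 1" if "q \<in> Q" for q
    by (rule cs_one_minus_square_le[OF Q_cs[OF that] x(2) b[OF that]])
  moreover have "star (1 - x * x) = 1 - x * x" using x(2) by simp
  ultimately obtain z where z: "(1 - z) * (1 - z) = 1 - (1 - x * x)" "star z = z" 
    "\<And>q. q \<in> Q \<Longrightarrow> q z \<le> 1" "\<And>y. y * (1 - x * x) = (1 - x * x) * y \<Longrightarrow> y * z = z * y"
    using sqrt_exists by blast
  define a where "a = 1 - z"
  have aa: "a * a = x * x" and sa: "star a = a" using z by (auto simp: a_def)
  have "x * z = z * x" by (rule z(4)) (simp add: algebra_simps)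
  then have xa: "x * a = a * x" by (simp add: a_def algebra_simps)
  have "a \<in> R"
    unfolding R_ran
  proof
    fix m assume "m \<in> M"
    then have "m * x = 0" using x(1) R_ran by blast
    then have "m * (a * a) = 0" unfolding aa by (simp add: mult.assoc[symmetric])
    then have "star (star (m * a)) * star (m * a) = 0" using sa by (simp add: mult.assoc[symmetric])
    then have "star (m * a) = 0" by (rule star_mult_eq_zero)
    then show "m * a = 0" by (metis star_star star_zero)
  qed
  then have "a - x \<in> R" "a + x \<in> R"
    using x(1) R_add[of a "smul (-1) x"] R_add[of a x] R_smul[OF x(1), of "-1"] by auto
  moreover have "(a - x) * (a + x) = 0" using xa aa by (simp add: algebra_simps)
  ultimately have "a - x = 0 \<or> a + x = 0" using R_zero_divisor[of "a - x" "a + x"] sa x(2) by simp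
  moreover have "1 - a = z" by (simp add: a_def)
  ultimately show ?thesis using z(3) by (auto simp: add_eq_0_iff2)
qed

lemma R_Pos_or:
  assumes x: "x \<in> R" "star x = x" and b: "C > 0" "\<And>q. q \<in> Q \<Longrightarrow> q x \<le> C"
  shows "(\<forall>q\<in>Q. q (smul (of_real C) 1 - x) \<le> C) \<or> (\<forall>q\<in>Q. q (smul (of_real C) 1 + x) \<le> C)"
proof -
  let ?x = "smul (of_real (1/C)) x"
  have "q ?x \<le> 1" if "q \<in> Q" for q using b that by (simp add: Q_smul norm_divide)
  then have *: "(\<forall>q\<in>Q. q (1 - ?x) \<le> 1) \<or> (\<forall>q\<in>Q. q (1 + ?x) \<le> 1)"
    using x R_smul by (intro R_abs) auto
  have eq: "smul (of_real C) 1 - x = smul (of_real C) (1 - ?x)" "smul (of_real C) 1 + x = smul (of_real C) (1 + ?x)"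
    using b(1) by (simp_all add: scale_right_diff_distrib scale_right_distrib)
  show ?thesis unfolding eq using * b(1) by (auto simp: Q_smul)
qed


text \<open>An intermediate value argument on [0, C]. For each l the element k^2 - l k is positive
  or negative, and both are closed conditions. It is positive at l = 0 and, since k is at most C,
  negative or zero at l = C. By connectedness both hold for some l, and \<open>Pos_antisym\<close>
  gives k^2 = l k.\<close>

lemma R_square_multiple_Pos:
  assumes k: "k \<in> R" "Pos k" "k \<noteq> 0" and b: "bounded_elt k"
  obtains l where "l \<noteq> 0" "k * k = smul (of_real l) k"
proof -
  have sk: "star k = k" using k(2) by (simp add: Pos_def)
  have kk: "k * k \<noteq> 0" using square_eq_zero[OF sk] k(3) by blast
  obtain C where C: "C > 0" "\<And>q. q \<in> Q \<Longrightarrow> q k \<le> C" using b unfolding bounded_elt_def by blast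
  define x where "x = (\<lambda>l::real. k * k - smul (of_real l) k)"
  \<comment> \<open>D bounds k^2 - l k for all l in [0, C]. One constant for every l makes
    \<open>T\<close> and \<open>T'\<close> intersections of closed sets.\<close>
  define D where "D = C * C + C * C"
  have D: "D > 0" using C(1) by (simp add: D_def)
  have x: "x l \<in> R" "star (x l) = x l" for l
    using R_add[OF R_mult[OF k(1), of k] R_smul[OF k(1), of "- of_real l"]] sk by (auto simp: x_def)
  have xD: "q (x l) \<le> D" if "0 \<le> l" "l \<le> C" "q \<in> Q" for l q
  proof -
    have "q (x l) \<le> q (k * k) + q (smul (of_real l) k)" unfolding x_def by (rule cs_diff_le[OF Q_cs[OF that(3)]])
    also have "q (k * k) \<le> C * C"
      using Q_mult[OF that(3), of k k] mult_mono[OF C(2) C(2)] Q_nonneg[OF that(3)] C(1) that(3) by fastforce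
    also have "q (smul (of_real l) k) \<le> C * C"
      unfolding Q_smul[OF that(3)] norm_of_real using that C(2)[OF that(3)] Q_nonneg[OF that(3), of k] C(1)
      by (intro mult_mono) auto
    finally show ?thesis by (simp add: D_def)
  qed
  define T where "T = (\<Inter>q\<in>Q. {l. q (smul (of_real D) 1 - x l) \<le> D})"
  define T' where "T' = (\<Inter>q\<in>Q. {l. q (smul (of_real D) 1 + x l) \<le> D})"
  have cover: "l \<in> T \<or> l \<in> T'" if "0 \<le> l" "l \<le> C" for l
    using R_Pos_or[OF x[of l] D] xD[OF that] unfolding T_def T'_def by blast
  have TPos: "Pos (x l)" if "l \<in> T" for l
    using that x(2) D by (intro PosI[of _ D]) (auto simp: T_def)
  have T'Pos: "Pos (- x l)" if "l \<in> T'" for l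
    using that x(2) D by (intro PosI[of _ D]) (auto simp: T'_def)
  have cont: "continuous_on UNIV (\<lambda>l::real. q (a + smul (of_real l) c))" if q: "q \<in> Q" for q a c
  proof (rule continuous_onI)
    fix l e :: real assume "e > 0"
    show "\<exists>d>0. \<forall>l'\<in>UNIV. dist l' l < d \<longrightarrow> dist (q (a + smul (of_real l') c)) (q (a + smul (of_real l) c)) \<le> e"
    proof (intro exI[of _ "e / (q c + 1)"] conjI ballI impI)
      have c: "q c \<ge> 0" using Q_nonneg[OF q] .
      then show "0 < e / (q c + 1)" using \<open>e > 0\<close> by simp
      fix l' assume "dist l' l < e / (q c + 1)"
      then have "\<bar>l' - l\<bar> * (q c + 1) < e" using c by (simp add: dist_real_def pos_less_divide_eq)
      then have *: "\<bar>l' - l\<bar> * q c < e" using c by (simp add: distrib_left)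
      have "(a + smul (of_real l') c) - (a + smul (of_real l) c) = smul (of_real (l' - l)) c"
        by (simp add: scale_left_diff_distrib)
      then have "q ((a + smul (of_real l') c) - (a + smul (of_real l) c)) = \<bar>l' - l\<bar> * q c"
        by (simp only: Q_smul[OF q] norm_of_real)
      then show "dist (q (a + smul (of_real l') c)) (q (a + smul (of_real l) c)) \<le> e"
        using * cs_le_add_diff[OF Q_cs[OF q], of "a + smul (of_real l') c" "a + smul (of_real l) c"]
          cs_le_add_diff[OF Q_cs[OF q], of "a + smul (of_real l) c" "a + smul (of_real l') c"]
          cs_diff_commute[OF Q_cs[OF q], of "a + smul (of_real l') c" "a + smul (of_real l) c"]
        unfolding dist_real_def by linarith
    qed
  qed
  have "closed T" "closed T'"
    unfolding T_def T'_def
  proof (safe intro!: closed_INT)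
    fix q assume q: "q \<in> Q"
    show "closed {l. q (smul (of_real D) 1 - x l) \<le> D}"
      using closed_Collect_le[OF cont[OF q, of "smul (of_real D) 1 - k * k" k] continuous_on_const]
      by (simp add: x_def algebra_simps)
    show "closed {l. q (smul (of_real D) 1 + x l) \<le> D}"
      using closed_Collect_le[OF cont[OF q, of "smul (of_real D) 1 + k * k" "- k"] continuous_on_const]
      by (simp add: x_def algebra_simps)
  qed
  moreover have "0 \<in> T"
  proof (rule ccontr)
    assume "0 \<notin> T"
    then have "Pos (- (k * k))" using cover[of 0] C(1) T'Pos[of 0] by (simp add: x_def)
    then show False using Pos_antisym[OF Pos_square[OF sk b]] kk by blast
  qed
  moreover have "C \<in> T' \<or> x C = 0"
  proof (rule disjCI)
    assume "x C \<noteq> 0"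
    \<comment> \<open>C - k is positive with constant C because C - (C - k) = k; its product with k
      is \<open>- x C\<close>.\<close>
    have "Pos (smul (of_real C) 1 - k)"
      using C sk by (intro PosI[of _ C]) auto
    then have "Pos (k * (smul (of_real C) 1 - k))" using k(2) by (intro Pos_mult) (simp_all add: algebra_simps)
    then have "Pos (- x C)" by (simp add: x_def algebra_simps)
    then have "\<not> Pos (x C)" using Pos_antisym \<open>x C \<noteq> 0\<close> by blast
    then show "C \<in> T'" using cover[of C] C(1) TPos by auto
  qed
  ultimately obtain l where "x l = 0"
  proof (cases "x C = 0")
    case False
    have "connected {0..C}" by simp
    moreover have "{0..C} \<subseteq> T \<union> T'" using cover by (meson UnI1 UnI2 atLeastAtMost_iff subsetI)
    moreover have "0 \<in> T \<inter> {0..C}" using \<open>0 \<in> T\<close> C(1) by simp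
    moreover have "C \<in> T' \<inter> {0..C}" using \<open>C \<in> T' \<or> x C = 0\<close> False C(1) by simp
    ultimately have "T \<inter> T' \<inter> {0..C} \<noteq> {}"
      using connected_closedD[OF _ _ _ \<open>closed T\<close> \<open>closed T'\<close>, of "{0..C}"] by blast
    then obtain l where "l \<in> T" "l \<in> T'" by blast
    then have "x l = 0" using Pos_antisym TPos T'Pos by blast
    then show ?thesis using that by blast
  qed
  then have "k * k = smul (of_real l) k" by (simp add: x_def)
  moreover from this kk have "l \<noteq> 0" by auto
  ultimately show ?thesis using that by blast
qed

lemma R_square_multiple:
  assumes k: "k \<in> R" "star k = k" "k \<noteq> 0" and b: "bounded_elt k"
  obtains l where "l \<noteq> 0" "k * k = smul (of_real l) k"
proof -
  obtain C where C: "C > 0" "\<And>q. q \<in> Q \<Longrightarrow> q k \<le> C" using b unfolding bounded_elt_def by blast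
  have m: "- k \<in> R" "bounded_elt (- k)" using R_smul[OF k(1), of "-1"] bounded_smul[OF b, of "-1"] by auto
  have "(\<forall>q\<in>Q. q (smul (of_real C) 1 - k) \<le> C) \<or> (\<forall>q\<in>Q. q (smul (of_real C) 1 + k) \<le> C)"
    using R_Pos_or[OF k(1,2) C(1)] C(2) by blast
  then show ?thesis
  proof
    assume "\<forall>q\<in>Q. q (smul (of_real C) 1 - k) \<le> C"
    then have "Pos k" using C(1) k(2) by (intro PosI[of _ C]) auto
    then show ?thesis using R_square_multiple_Pos[OF k(1) _ k(3) b] that by blast
  next
    assume "\<forall>q\<in>Q. q (smul (of_real C) 1 + k) \<le> C"
    then have "Pos (- k)" using C(1) k(2) by (intro PosI[of _ C]) auto
    then obtain l where "l \<noteq> 0" "- k * - k = smul (of_real l) (- k)"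
      using R_square_multiple_Pos[OF m(1) _ _ m(2)] k(3) by (metis neg_equal_0_iff_equal)
    then show ?thesis using that[of "- l"] by simp
  qed
qed

text \<open>The bounded transform k of a * \<open>star a\<close> lies in R and satisfies k^2 = l k,
  so e = k / l is a projection. That e A e consists of multiples of e is checked for bounded
  self-adjoint elements, then for all self-adjoint ones, then for all.\<close>

lemma R_minproj:
  assumes a: "a \<in> R" "a \<noteq> 0"
  obtains e where "minproj e" "e \<in> R"
proof -
  have h: "a * star a \<in> R" "star (a * star a) = a * star a" using R_mult[OF a(1)] by auto
  have h0: "a * star a \<noteq> 0" using star_mult_eq_zero[of "star a"] a(2) star_zero star_star by metis
  obtain y where y: "star (a * star a * y) = a * star a * y" "bounded_elt (a * star a * y)"
     "a * star a * y = 0 \<Longrightarrow> a * star a = 0"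
    using bounded_transform[OF h(2)] by blast
  define k where "k = a * star a * y"
  have k: "k \<in> R" "star k = k" "bounded_elt k" "k \<noteq> 0"
    using R_mult[OF h(1)] y h0 by (auto simp: k_def)
  obtain l where l: "l \<noteq> 0" "k * k = smul (of_real l) k" using R_square_multiple[OF k(1,2,4,3)] by blast
  define e where "e = smul (of_real (1 / l)) k"
  have e: "e \<in> R" "star e = e" "e * e = e" "e \<noteq> 0" using k R_smul l by (auto simp: e_def)
  have bdd: "\<exists>c. x = smul (of_real c) e" if x: "star x = x" "e * x = x" "x * e = x" "bounded_elt x" for x
  proof (cases "x = 0")
    case True
    then show ?thesis by (intro exI[of _ 0]) simp
  next
    case False
    have "x \<in> R" using R_mult[OF e(1), of x] x(2) by simp
    then obtain c where c: "c \<noteq> 0" "x * x = smul (of_real c) x" 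
      using R_square_multiple[OF _ x(1) False x(4)] by blast
    define f where "f = smul (of_real (1 / c)) x"
    have f: "f \<in> R" "star f = f" "f * f = f" "f \<noteq> 0" "f * e = f" 
      using \<open>x \<in> R\<close> R_smul x c False by (auto simp: f_def)
    \<comment> \<open>The projection f has left annihilator M, and (1 - f) f = 0. As M annihilates e
      from the left, e = f e = f.\<close>
    have "1 - f \<in> M" using R_lan[OF f(1,2,4), of "1 - f"] f(3) by (simp add: left_diff_distrib)
    then have "(1 - f) * e = 0" using e(1) R_ran by blast
    then have "e = f" using f(5) by (simp add: left_diff_distrib)
    then show ?thesis using c(1) by (intro exI[of _ c]) (simp add: f_def)
  qed
  have sa: "\<exists>c. x = smul (of_real c) e" if x: "star x = x" "e * x = x" "x * e = x" for x
  proof -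
    obtain y where y: "(1 + x * x) * y = 1" "star y = y" "\<And>u. u * x = x * u \<Longrightarrow> u * y = y * u"
        "star (x * y) = x * y" "bounded_elt (x * y)" "x * y = 0 \<Longrightarrow> x = 0"
      using bounded_transform[OF x(1)] by blast
    have "e * (x * y) = x * y" using x(2) by (simp add: mult.assoc[symmetric])
    moreover have "x * y * e = x * y" using arg_cong[OF calculation, of star] y(4) e(2) 
      by (metis star_mult)
    ultimately obtain c where c: "x * y = smul (of_real c) e" using bdd[OF y(4)] y(5) by blast
    show ?thesis
    proof (cases "c = 0")
      case True
      then have "x = 0" using y(6) c by simp
      then show ?thesis by (intro exI[of _ 0]) simp
    next
      case False
      have "y * (1 + x * x) = 1" using y(1) y(3)[of x] by (metis y(2) arg_cong[OF y(1), of star] star_mult star_add star_one x(1))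
      then have "x = x * y * (1 + x * x)" by (simp add: mult.assoc)
      \<comment> \<open>From x = c (e + x^2) one gets x^2 = x / c - e. This is a quadratic
        inequality for q x with constants independent of q, so x is bounded after all.\<close>
      then have "x = smul (of_real c) e + smul (of_real c) (x * x)"
        unfolding c using x(2) by (simp add: distrib_left scale_right_distrib mult.assoc[symmetric])
      then have "smul (of_real (1 / c)) x = smul (of_real (1 / c)) (smul (of_real c) e + smul (of_real c) (x * x))"
        by simp
      then have xx: "x * x = smul (of_real (1 / c)) x - e" 
        using False by (simp add: scale_right_distrib)
      have "bounded_elt x"
      proof (rule bounded_eltI)
        fix q assume q: "q \<in> Q"
        have "q e * q e = q e" using Q_square[OF q e(2)] e(3) by (simp add: power2_eq_square)
        then have "q e \<le> 1" by (cases "q e = 0") auto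
        have "(q x)\<^sup>2 = q (smul (of_real (1 / c)) x - e)" using Q_square[OF q x(1)] xx by simp
        also have "\<dots> \<le> q (smul (of_real (1 / c)) x) + q e" by (rule cs_diff_le[OF Q_cs[OF q]])
        also have "q (smul (of_real (1 / c)) x) = \<bar>1 / c\<bar> * q x" by (simp only: Q_smul[OF q] norm_of_real)
        finally have *: "(q x)\<^sup>2 \<le> \<bar>1 / c\<bar> * q x + 1" using \<open>q e \<le> 1\<close> by simp
        show "q x \<le> \<bar>1 / c\<bar> + 1"
        proof (rule ccontr)
          assume "\<not> q x \<le> \<bar>1 / c\<bar> + 1"
          then have 1: "(\<bar>1 / c\<bar> + 1) * q x \<le> q x * q x" "q x > 1" 
            by (smt (verit) mult_right_mono abs_ge_zero)+
          then show False using * by (simp add: power2_eq_square distrib_right)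
        qed
      qed
      then show ?thesis using bdd[OF x] by blast
    qed
  qed
  have "\<exists>c. e * b * e = smul c e" for b
  proof -
    obtain b1 b2 where b: "star b1 = b1" "star b2 = b2" "b = b1 + smul \<i> b2" 
      by (rule real_imag_decomposition)
    have "\<exists>c. e * u * e = smul (of_real c) e" if "star u = u" for u
      using that e(2,3) by (intro sa) (simp_all add: mult.assoc, simp_all add: mult.assoc[symmetric])
    then obtain c1 c2 where "e * b1 * e = smul (of_real c1) e" "e * b2 * e = smul (of_real c2) e"
      using b(1,2) by meson
    then have "e * b * e = smul (of_real c1 + \<i> * of_real c2) e"
      unfolding b(3) by (simp add: distrib_left distrib_right scale_left_distrib)
    then show ?thesis by blast
  qed
  then have "minproj e" using e unfolding minproj_def by blast
  then show ?thesis using that e(1) by blast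
qed

end

text \<open>Closedness is spelled out with single seminorms of \<open>Q\<close>, which
  \<open>closedin_iff\<close> identifies with closedness in the topology. Right ideals are left out,
  since the involution exchanges the two sides.\<close>

definition left_annihilator_property :: bool where
  "left_annihilator_property \<longleftrightarrow> (\<forall>J. left_ideal smul J \<longrightarrow>
     (\<forall>x. x \<notin> J \<longrightarrow> (\<exists>q\<in>Q. \<exists>e>0. \<forall>y\<in>J. e \<le> q (x - y))) \<longrightarrow> J \<noteq> UNIV \<longrightarrow> 
     (\<exists>a. a \<noteq> 0 \<and> (\<forall>s\<in>J. s * a = 0)))"

section \<open>Maximal left ideals and the density of the socle\<close>

lemma left_ideal_closure:
  assumes J: "left_ideal smul J" and q: "q \<in> Q"
  shows "left_ideal smul {x. \<forall>e>0. \<exists>m\<in>J. q (x - m) < e}" (is "left_ideal smul ?cl")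
  unfolding left_ideal_def
proof (intro conjI ballI allI)
  have J': "0 \<in> J" "\<And>x y. x \<in> J \<Longrightarrow> y \<in> J \<Longrightarrow> x + y \<in> J" 
    "\<And>c x. x \<in> J \<Longrightarrow> smul c x \<in> J" "\<And>a x. x \<in> J \<Longrightarrow> a * x \<in> J"
    using J unfolding left_ideal_def by auto
  show "0 \<in> ?cl" using J'(1) Q_zero[OF q] by (auto intro!: bexI[of _ 0])
  fix x assume x: "x \<in> ?cl"
  show "x + y \<in> ?cl" if y: "y \<in> ?cl" for y
  proof (intro CollectI allI impI)
    fix e :: real assume "e > 0"
    then have "e / 2 > 0" by simp
    then obtain m n where mn: "m \<in> J" "q (x - m) < e / 2" "n \<in> J" "q (y - n) < e / 2"
      using x y by blast
    moreover have "q (x + y - (m + n)) \<le> q (x - m) + q (y - n)"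
      using Q_triangle[OF q, of "x - m" "y - n"] by (simp add: algebra_simps)
    ultimately show "\<exists>k\<in>J. q (x + y - k) < e" using J'(2) by (intro bexI[of _ "m + n"]) auto
  qed
  \<comment> \<open>Scalar multiplication and left multiplication are both Lipschitz for q and
    preserve J, so one argument treats them.\<close>
  have lip: "g x \<in> ?cl" if g: "\<And>m. m \<in> J \<Longrightarrow> g m \<in> J" "\<And>m. q (g x - g m) \<le> C * q (x - m)" "C \<ge> 0" for g C
  proof (intro CollectI allI impI)
    fix e :: real assume "e > 0"
    with g(3) have "e / (C + 1) > 0" by simp
    then obtain m where m: "m \<in> J" "q (x - m) < e / (C + 1)" using x by blast
    then have "(C + 1) * q (x - m) < e" using g(3) by (simp add: field_simps)
    moreover have "C * q (x - m) \<le> (C + 1) * q (x - m)" using Q_nonneg[OF q] by (simp add: distrib_right)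
    ultimately have "q (g x - g m) < e" using g(2)[of m] by linarith
    then show "\<exists>k\<in>J. q (g x - k) < e" using m(1) g(1) by blast
  qed
  show "smul c x \<in> ?cl" for c
    using lip[of "smul c" "cmod c"] J'(3) by (simp add: Q_smul[OF q] flip: scale_right_diff_distrib)
  show "a * x \<in> ?cl" for a
    using lip[of "(*) a" "q a"] J'(4) Q_mult[OF q] Q_nonneg[OF q] by (simp flip: right_diff_distrib)
qed

text \<open>Avoiding the open q-ball of radius 1 around 1 takes the place of properness. The
  condition survives unions of chains, as Zorn's lemma requires, and also q-closures.\<close>

lemma maximal_left_ideal:
  assumes J: "left_ideal smul J" "\<And>x. x \<in> J \<Longrightarrow> 1 \<le> q (1 - x)"
  obtains M where "left_ideal smul M" "J \<subseteq> M" "\<And>x. x \<in> M \<Longrightarrow> 1 \<le> q (1 - x)"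
    "\<And>N. left_ideal smul N \<Longrightarrow> M \<subseteq> N \<Longrightarrow> (\<And>x. x \<in> N \<Longrightarrow> 1 \<le> q (1 - x)) \<Longrightarrow> N = M"
proof -
  define \<A> where "\<A> = {N. left_ideal smul N \<and> J \<subseteq> N \<and> (\<forall>x\<in>N. 1 \<le> q (1 - x))}"
  have "\<exists>M\<in>\<A>. \<forall>X\<in>\<A>. M \<subseteq> X \<longrightarrow> X = M"
  proof (rule subset_Zorn_nonempty)
    show "\<A> \<noteq> {}" using J by (auto simp: \<A>_def)
    fix \<C> assume ne: "\<C> \<noteq> {}" and ch: "subset.chain \<A> \<C>"
    have mem: "left_ideal smul N" "J \<subseteq> N" "\<forall>x\<in>N. 1 \<le> q (1 - x)" if "N \<in> \<C>" for N
      using ch that by (auto simp: \<A>_def subset.chain_def)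
    have "left_ideal smul (\<Union>\<C>)"
      unfolding left_ideal_def
    proof (intro conjI ballI allI)
      show "0 \<in> \<Union>\<C>" using ne mem(1) unfolding left_ideal_def by blast
      fix x assume x: "x \<in> \<Union>\<C>"
      then obtain N where N: "N \<in> \<C>" "x \<in> N" by blast
      show "smul c x \<in> \<Union>\<C>" for c using N mem(1) unfolding left_ideal_def by blast
      show "a * x \<in> \<Union>\<C>" for a using N mem(1) unfolding left_ideal_def by blast
      show "x + y \<in> \<Union>\<C>" if y: "y \<in> \<Union>\<C>" for y
      proof -
        obtain N' where N': "N' \<in> \<C>" "y \<in> N'" using y by blast
        have "N \<subseteq> N' \<or> N' \<subseteq> N" using ch N(1) N'(1) unfolding subset_chain_def by blast
        then show ?thesis using N N' mem(1) unfolding left_ideal_def by blast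
      qed
    qed
    moreover have "J \<subseteq> \<Union>\<C>" using ne mem(2) by blast
    ultimately show "\<Union>\<C> \<in> \<A>" using mem(3) by (auto simp: \<A>_def)
  qed
  then obtain M where M: "M \<in> \<A>" "\<And>X. X \<in> \<A> \<Longrightarrow> M \<subseteq> X \<Longrightarrow> X = M" by blast
  show ?thesis
  proof
    show "left_ideal smul M" "J \<subseteq> M" "\<And>x. x \<in> M \<Longrightarrow> 1 \<le> q (1 - x)" using M(1) by (auto simp: \<A>_def)
    show "N = M" if "left_ideal smul N" "M \<subseteq> N" "\<And>x. x \<in> N \<Longrightarrow> 1 \<le> q (1 - x)" for N
      using M that by (auto simp: \<A>_def)
  qed
qed

lemma minproj_exists:
  assumes ann: left_annihilator_property and q: "q \<in> Q"
    and J: "left_ideal smul J" "\<And>x. x \<in> J \<Longrightarrow> 1 \<le> q (1 - x)"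
  obtains e where "minproj e" "\<And>x. x \<in> J \<Longrightarrow> x * e = 0"
proof -
  obtain M where M: "left_ideal smul M" "J \<subseteq> M" "\<And>x. x \<in> M \<Longrightarrow> 1 \<le> q (1 - x)"
    and max: "\<And>N. left_ideal smul N \<Longrightarrow> M \<subseteq> N \<Longrightarrow> (\<And>x. x \<in> N \<Longrightarrow> 1 \<le> q (1 - x)) \<Longrightarrow> N = M"
    using maximal_left_ideal[of J q] J by blast
  let ?cl = "{x. \<forall>e>0. \<exists>m\<in>M. q (x - m) < e}"
  \<comment> \<open>By maximality M equals its closure for the single seminorm q, hence it is closed
    in the topology and the annihilator property applies.\<close>
  have cl: "?cl = M"
  proof (rule max)
    show "left_ideal smul ?cl" by (rule left_ideal_closure[OF M(1) q])
    show "M \<subseteq> ?cl" using Q_zero[OF q] by (auto intro!: bexI)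
    fix x assume x: "x \<in> ?cl"
    show "1 \<le> q (1 - x)"
    proof (rule ccontr)
      assume "\<not> 1 \<le> q (1 - x)"
      then have "1 - q (1 - x) > 0" by simp
      then obtain m where "m \<in> M" "q (x - m) < 1 - q (1 - x)" using x by blast
      then show False using M(3)[of m] cs_diff_triangle[OF Q_cs[OF q], of 1 m x] by simp
    qed
  qed
  define R where "R = {a. \<forall>m\<in>M. m * a = 0}"
  have "0 \<in> M" using M(1) by (simp add: left_ideal_def)
  have "1 \<notin> M" using M(3)[of 1] Q_zero[OF q] by auto
  then have "M \<noteq> UNIV" by blast
  moreover have "\<exists>q\<in>Q. \<exists>e>0. \<forall>y\<in>M. e \<le> q (x - y)" if x: "x \<notin> M" for x
  proof -
    have "x \<notin> ?cl" unfolding cl by (rule x)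
    then obtain e where "e > 0" "\<forall>m\<in>M. \<not> q (x - m) < e" by blast
    then show ?thesis using q by (intro bexI[of _ q] exI[of _ e]) (auto simp: not_less)
  qed
  ultimately obtain a where a: "a \<in> R" "a \<noteq> 0"
    using ann M(1) unfolding left_annihilator_property_def R_def by blast
  have lan: "b * x = 0 \<longleftrightarrow> b \<in> M" if x: "x \<in> R" "star x = x" "x \<noteq> 0" for x b
  proof
    let ?N = "{b. b * x = 0}"
    \<comment> \<open>The left annihilator of x contains M and still avoids the ball. Otherwise q (1
      - b) < 1 for some b with b x = 0, which forces q x = 0, so that x lies in the q-closed ideal M
      and x * x = 0.\<close>
    have "?N = M"
    proof (rule max)
      show "left_ideal smul ?N" by (auto simp: left_ideal_def distrib_right mult.assoc)
      show "M \<subseteq> ?N" using x(1) by (auto simp: R_def)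
      fix b assume "b \<in> ?N"
      show "1 \<le> q (1 - b)"
      proof (rule ccontr)
        assume "\<not> 1 \<le> q (1 - b)"
        moreover have "q x \<le> q (1 - b) * q x"
          using Q_mult[OF q, of "1 - b" x] \<open>b \<in> ?N\<close> by (simp add: left_diff_distrib)
        ultimately have "q x = 0"
          using Q_nonneg[OF q, of x] by (metis mult_le_cancel_right1 not_less order_le_less)
        then have "x \<in> ?cl" using \<open>0 \<in> M\<close> by (auto intro!: bexI[of _ 0])
        then have "x * x = 0" using cl x(1) by (auto simp: R_def)
        then show False using square_eq_zero x(2,3) by blast
      qed
    qed
    then show "b * x = 0 \<Longrightarrow> b \<in> M" by blast
  qed (use x(1) in \<open>auto simp: R_def\<close>)
  obtain e where "minproj e" "e \<in> R"
  proof (rule R_minproj[of R M, OF _ _ _ lan _ a])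
    show "x * b \<in> R" if "x \<in> R" for x b using that by (auto simp: R_def mult.assoc[symmetric])
    show "x + y \<in> R" if "x \<in> R" "y \<in> R" for x y using that by (auto simp: R_def distrib_left)
    show "smul c x \<in> R" if "x \<in> R" for x c using that by (auto simp: R_def)
    show "x \<in> R \<longleftrightarrow> (\<forall>a\<in>M. a * x = 0)" for x by (simp add: R_def)
  qed
  then show ?thesis using that M(2) unfolding R_def by blast
qed

text \<open>Otherwise \<open>minproj_exists\<close> gives a minimal projection e annihilated by S
  from the left; but e is in S, so e = e e = 0. It is applied to the span of the left ideals A e and
  to an annihilator ideal in \<open>seminorm_le_sum\<close>.\<close>

lemma left_ideal_with_minprojs_dense:
  assumes left_annihilator_property "q \<in> Q" and S: "left_ideal smul S" "\<And>e. minproj e \<Longrightarrow> e \<in> S"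
  obtains x where "x \<in> S" "q (1 - x) < 1"
proof (rule ccontr)
  assume "\<not> thesis"
  then have "1 \<le> q (1 - x)" if "x \<in> S" for x using that \<open>\<And>x. x \<in> S \<Longrightarrow> q (1 - x) < 1 \<Longrightarrow> thesis\<close> by force
  then obtain e where "minproj e" "\<And>x. x \<in> S \<Longrightarrow> x * e = 0"
    using minproj_exists[OF assms(1,2) S(1)] by blast
  then have "e * e = 0" using S(2) by blast
  then show False using \<open>minproj e\<close> by (auto simp: minproj_def)
qed

text \<open>Here the unit matters: only 1 has to be approximated, and one finite set F does it. Both
  finiteness results, \<open>orthonormal_card_bound\<close> and \<open>finite_support\<close>, rest
  on this.\<close>

lemma socle_approx:
  assumes left_annihilator_property "q \<in> Q"
  obtains F a where "finite F" "\<And>e. e \<in> F \<Longrightarrow> minproj e" "q (1 - (\<Sum>e\<in>F. a e * e)) < 1"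
proof -
  define S where "S = {x. \<exists>F a. finite F \<and> F \<subseteq> Collect minproj \<and> x = (\<Sum>e\<in>F. a e * e)}"
  have "left_ideal smul S"
    unfolding left_ideal_def
  proof (intro conjI ballI allI)
    show "0 \<in> S" unfolding S_def by (auto intro!: exI[of _ "{}"])
    fix x assume "x \<in> S"
    then obtain F a where F: "finite F" "F \<subseteq> Collect minproj" "x = (\<Sum>e\<in>F. a e * e)" by (auto simp: S_def)
    show "smul c x \<in> S" for c
      unfolding S_def using F by (auto intro!: exI[of _ F] exI[of _ "\<lambda>e. smul c (a e)"] simp: scale_sum_right)
    show "b * x \<in> S" for b
      unfolding S_def using F by (auto intro!: exI[of _ F] exI[of _ "\<lambda>e. b * a e"] simp: sum_distrib_left mult.assoc)
    show "x + y \<in> S" if y: "y \<in> S" for y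
    proof -
      obtain G b where G: "finite G" "G \<subseteq> Collect minproj" "y = (\<Sum>e\<in>G. b e * e)" using y by (auto simp: S_def)
      have "(\<Sum>e\<in>F. a e * e) = (\<Sum>e\<in>F \<union> G. (if e \<in> F then a e else 0) * e)"
        using F(1) G(1) by (intro sum.mono_neutral_cong_left) auto
      moreover have "(\<Sum>e\<in>G. b e * e) = (\<Sum>e\<in>F \<union> G. (if e \<in> G then b e else 0) * e)"
        using F(1) G(1) by (intro sum.mono_neutral_cong_left) auto
      ultimately have "x + y = (\<Sum>e\<in>F \<union> G. ((if e \<in> F then a e else 0) + (if e \<in> G then b e else 0)) * e)"
        using F(3) G(3) by (simp add: distrib_right sum.distrib)
      then show ?thesis
        using F(1,2) G(1,2) unfolding S_def 
        by (intro CollectI exI[of _ "F \<union> G"] exI[of _ "\<lambda>e. (if e \<in> F then a e else 0) + (if e \<in> G then b e else 0)"]) auto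
    qed
  qed
  moreover have "e \<in> S" if "minproj e" for e
    unfolding S_def using that by (intro CollectI exI[of _ "{e}"] exI[of _ "\<lambda>_. 1"]) auto
  ultimately obtain x where "x \<in> S" "q (1 - x) < 1" 
    using left_ideal_with_minprojs_dense[OF assms] by blast
  then show ?thesis using that unfolding S_def by blast
qed

text \<open>Write v = y v + (1 - y) v: modulo the kernel of q, left multiplication by such a y is
  injective.\<close>

lemma contraction_eq_zero:
  assumes "q \<in> Q" "q (1 - y) < 1" "q (y * v) = 0" shows "q v = 0"
proof -
  have "q v \<le> q (y * v) + q (v - y * v)" by (rule cs_le_add_diff[OF Q_cs[OF assms(1)]])
  also have "v - y * v = (1 - y) * v" by (simp add: left_diff_distrib)
  finally have "q v \<le> q (1 - y) * q v" using Q_mult[OF assms(1), of "1 - y" v] assms(3) by simp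
  then show ?thesis using Q_nonneg[OF assms(1), of v] assms(2) 
    by (metis mult_le_cancel_right1 not_less order_le_less)
qed

section \<open>The inner product space A e of a minimal projection e\<close>

context
  fixes e assumes e: "minproj e"
begin

lemma minproj_simps: "star e = e" "e * e = e" "e \<noteq> 0"
  using e by (auto simp: minproj_def)

lemma minproj_form:
  assumes "u * e = u" "v * e = v"
  obtains c where "star u * v = smul c e"
proof -
  have "star u * v = e * (star u * v) * e" 
    using assms(2) arg_cong[OF assms(1), of star] minproj_simps(1) by (simp add: mult.assoc[symmetric]) (simp add: mult.assoc)
  then show ?thesis using that e unfolding minproj_def by metis
qed

text \<open>The form \<open>star u * v\<close> on \<open>A e\<close> is anisotropic and takes the value 1 at \<open>e\<close>. If it were negative at
  \<open>u\<close>, it would vanish somewhere on the line through \<open>e\<close> and \<open>u\<close>.\<close>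
lemma minproj_form_pos:
  assumes u: "u * e = u" "u \<noteq> 0"
  obtains r where "r > 0" "star u * u = smul (of_real r) e"
proof -
  obtain c where c: "star u * u = smul c e" using minproj_form[OF u(1,1)] by blast
  have "star (smul c e) = smul c e" unfolding c[symmetric] by simp
  then have "smul (cnj c) e = smul c e" using minproj_simps(1) by simp
  then have "cnj c = c" using minproj_simps(3) by simp
  then obtain r where r: "c = of_real r" using Reals_cnj_iff Reals_cases by metis
  have "r \<noteq> 0" using c r star_mult_eq_zero[of u] u(2) by auto
  moreover have "\<not> r < 0"
  proof
    assume neg: "r < 0"
    obtain d where d: "star e * u = smul d e" using minproj_form[OF minproj_simps(2) u(1)] by blast
    have d': "star u * e = smul (cnj d) e" using arg_cong[OF d, of star] minproj_simps(1) by simp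
    \<comment> \<open>D is a quarter of the discriminant of 1 + 2 t Re d + t^2 r, the value of the
      form at e + t u; t is a real root.\<close>
    define D where "D = (Re d)\<^sup>2 - r"
    have "D \<ge> 0" using neg by (simp add: D_def) (smt (verit) zero_le_power2)
    define t where "t = (- Re d + sqrt D) / r"
    have "r * t = - Re d + sqrt D" using neg by (simp add: t_def)
    then have "(r * t + Re d)\<^sup>2 = D" using \<open>D \<ge> 0\<close> by simp
    then have "r * (1 + 2 * t * Re d + t * t * r) = 0" by (simp add: D_def power2_eq_square algebra_simps)
    then have t: "1 + 2 * t * Re d + t * t * r = 0" using neg by simp
    define v where "v = e + smul (of_real t) u"
    have "star v * v = e + smul (of_real t) (smul d e) + smul (of_real t) (smul (cnj d) e) 
        + smul (of_real t * of_real t) (smul (of_real r) e)"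
      using d d' c minproj_simps(1,2) unfolding v_def r
      by (simp add: distrib_left distrib_right scale_right_distrib)
    also have "\<dots> = smul (of_real (1 + 2 * t * Re d + t * t * r)) e"
    proof -
      have "(of_real (1 + 2 * t * Re d + t * t * r) :: complex) 
         = 1 + of_real t * d + of_real t * cnj d + of_real t * of_real t * of_real r"
        by (simp add: complex_eq_iff)
      then show ?thesis by (simp only: scale_left_distrib scale_scale scale_one mult.assoc)
    qed
    also have "\<dots> = 0" using t by simp
    \<comment> \<open>Anisotropy makes e a real multiple of u, so the form at e would be
      nonpositive, although it is 1.\<close>
    finally have "v = 0" by (rule star_mult_eq_zero)
    then have eu: "e = smul (of_real (- t)) u" by (simp add: v_def add_eq_0_iff2)
    have "star e * e = smul (of_real (- t) * of_real (- t)) (star u * u)"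
      by (subst (1 2) eu) simp
    then have "smul 1 e = smul (of_real (t * t * r)) e" using c r minproj_simps(1,2) by simp
    then have "(1::complex) = of_real (t * t * r)" using minproj_simps(3) unfolding scale_cancel_right by blast
    then have "1 = t * t * r" by (metis of_real_eq_1_iff)
    moreover have "t * t * r \<le> 0" using neg by (simp add: mult_nonneg_nonpos)
    ultimately show False by linarith
  qed
  ultimately show ?thesis using that[of r] c r by simp
qed

lemma minproj_normalize:
  assumes u: "u * e = u" "u \<noteq> 0"
  obtains c where "c \<noteq> 0" "star (smul c u) * smul c u = e"
proof -
  obtain r where r: "r > 0" "star u * u = smul (of_real r) e" using minproj_form_pos[OF u] by blast
  have "of_real (1 / sqrt r) * of_real (1 / sqrt r) * of_real r = (1 :: complex)"
    unfolding of_real_mult[symmetric] of_real_eq_1_iff using r(1) by simp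
  then have "star (smul (of_real (1 / sqrt r)) u) * smul (of_real (1 / sqrt r)) u = e"
    using r by (simp del: of_real_divide add: mult.assoc)
  then show ?thesis using that[of "of_real (1 / sqrt r)"] r(1) by simp
qed

text \<open>The space f A e has dimension at most 1. For v, w in it, w * \<open>star v\<close> lies
  in f A f and is a multiple of f, so w * \<open>star v\<close> * v is both a multiple of v and a
  nonzero multiple of w.\<close>

lemma minproj_one_dim:
  assumes f: "minproj f"
  obtains b where "\<And>v. f * v = v \<Longrightarrow> v * e = v \<Longrightarrow> v \<in> span {b}"
proof (cases "\<exists>v. f * v = v \<and> v * e = v \<and> v \<noteq> 0")
  case True
  then obtain v where v: "f * v = v" "v * e = v" "v \<noteq> 0" by blast
  obtain r where r: "r > 0" "star v * v = smul (of_real r) e" using minproj_form_pos[OF v(2,3)] by blast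
  have "w \<in> span {v}" if w: "f * w = w" "w * e = w" for w
  proof -
    have "star f = f" using f by (simp add: minproj_def)
    then have sv: "star v * f = star v" using arg_cong[OF v(1), of star] by simp
    obtain l where "f * (w * star v) * f = smul l f" using f unfolding minproj_def by blast
    moreover have "f * (w * star v) * f = f * w * (star v * f)" by (simp add: mult.assoc)
    ultimately have l: "w * star v = smul l f" using w(1) sv by simp
    have "w * (star v * v) = smul (of_real r) w" using r(2) w(2) by simp
    moreover have "w * (star v * v) = w * star v * v" by (simp add: mult.assoc)
    ultimately have "smul (of_real r) w = smul l v" using l v(1) by simp
    then have "smul (of_real (1 / r)) (smul (of_real r) w) = smul (of_real (1 / r)) (smul l v)" by simp
    then have "w = smul (of_real (1 / r) * l) v" using r(1) by simp
    then show ?thesis by (simp add: span_base span_scale)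
  qed
  then show ?thesis using that by blast
next
  case False
  then show ?thesis using that[of 0] span_zero by metis
qed

definition orthonormal :: "'a set \<Rightarrow> bool" where
  "orthonormal U \<longleftrightarrow> finite U \<and> (\<forall>u\<in>U. u * e = u) \<and> (\<forall>u\<in>U. \<forall>v\<in>U. star u * v = (if u = v then e else 0))"

text \<open>An element y close to 1 acts injectively on A e and maps it into a finite sum of spaces
  f A e, each of dimension at most 1.\<close>

lemma orthonormal_card_bound:
  assumes left_annihilator_property
  obtains n where "\<And>U. orthonormal U \<Longrightarrow> card U \<le> n"
proof -
  \<comment> \<open>With q e nonzero, q vanishes at no nonzero element of A e, because (q v)^2 is q
    e times a positive number.\<close>
  obtain q where q: "q \<in> Q" "q e \<noteq> 0" using Q_separating minproj_simps(3) by blast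
  obtain F a where F: "finite F" "\<And>f. f \<in> F \<Longrightarrow> minproj f" "q (1 - (\<Sum>f\<in>F. a f * f)) < 1"
    using socle_approx[OF assms q(1)] by blast
  \<comment> \<open>The adjoint of the approximation to 1 is used so that the projections f stand on
    the left and y v falls into the sum of the spaces f A e.\<close>
  define y where "y = (\<Sum>f\<in>F. f * star (a f))"
  have "star (1 - (\<Sum>f\<in>F. a f * f)) = 1 - y"
    using F(2) by (simp add: y_def minproj_def)
  then have y1: "q (1 - y) < 1" using F(3) Q_star[OF q(1)] by metis
  have inj: "v = 0" if v: "v * e = v" "y * v = 0" for v
  proof (rule ccontr)
    assume "v \<noteq> 0"
    then obtain r where r: "r > 0" "star v * v = smul (of_real r) e" using minproj_form_pos[OF v(1)] by blast
    have "q v = 0" using contraction_eq_zero[OF q(1) y1] v(2) Q_zero[OF q(1)] by simp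
    then have "q (star v * v) = 0" using cs_star_mult[OF Q_cs[OF q(1)], of v] by simp
    then show False using r q(2) by (simp add: Q_smul[OF q(1)])
  qed
  have "\<forall>f\<in>F. \<exists>b. \<forall>v. f * v = v \<longrightarrow> v * e = v \<longrightarrow> v \<in> span {b}"
    using minproj_one_dim F(2) by metis
  then obtain b where b: "\<And>f v. f \<in> F \<Longrightarrow> f * v = v \<Longrightarrow> v * e = v \<Longrightarrow> v \<in> span {b f}" by metis
  have "card U \<le> card (b ` F)" if U: "orthonormal U" for U
  proof -
    have fin: "finite U" and Ue: "\<And>u. u \<in> U \<Longrightarrow> u * e = u" 
      and orth: "\<And>u v. u \<in> U \<Longrightarrow> v \<in> U \<Longrightarrow> star u * v = (if u = v then e else 0)"
      using U by (auto simp: orthonormal_def)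
    have yi: "inj_on ((*) y) U"
    proof (rule inj_onI)
      fix u v assume "u \<in> U" "v \<in> U" "y * u = y * v"
      then have "u - v = 0" using inj[of "u - v"] Ue by (simp add: left_diff_distrib right_diff_distrib)
      then show "u = v" by simp
    qed
    have "independent ((*) y ` U)"
    proof (rule independent_if_scalars_zero)
      show "finite ((*) y ` U)" using fin by simp
      fix g w assume g: "(\<Sum>x\<in>(*) y ` U. smul (g x) x) = 0" and "w \<in> (*) y ` U"
      then obtain u where u: "u \<in> U" "w = y * u" by blast
      define v where "v = (\<Sum>x\<in>U. smul (g (y * x)) x)"
      have "y * v = 0" using g unfolding sum.reindex[OF yi] by (simp add: v_def sum_distrib_left o_def)
      moreover have "v * e = v" using Ue by (simp add: v_def sum_distrib_right)
      ultimately have "v = 0" by (rule inj[rotated])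
      then have "0 = star u * v" by simp
      also have "\<dots> = (\<Sum>x\<in>U. smul (g (y * x)) (if u = x then e else 0))"
        using orth u(1) by (simp add: v_def sum_distrib_left)
      also have "\<dots> = (\<Sum>x\<in>U. if u = x then smul (g (y * x)) e else 0)" by (intro sum.cong) auto
      also have "\<dots> = smul (g (y * u)) e" using fin u(1) by simp
      finally show "g w = 0" using u(2) minproj_simps(3) by simp
    qed
    moreover have "(*) y ` U \<subseteq> span (b ` F)"
    proof
      fix w assume "w \<in> (*) y ` U"
      then obtain u where u: "u \<in> U" "w = y * u" by blast
      have "f * star (a f) * u \<in> span (b ` F)" if f: "f \<in> F" for f
      proof -
        have "f * f = f" using F(2)[OF f] by (simp add: minproj_def)
        then have "f * (f * star (a f) * u) = f * star (a f) * u" by (simp add: mult.assoc[symmetric])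
        moreover have "f * star (a f) * u * e = f * star (a f) * u" using Ue[OF u(1)] by (simp add: mult.assoc)
        ultimately have "f * star (a f) * u \<in> span {b f}" using b[OF f] by blast
        then show ?thesis using span_mono[of "{b f}" "b ` F"] f by blast
      qed
      then show "w \<in> span (b ` F)" unfolding u(2) y_def sum_distrib_right by (rule span_sum)
    qed
    ultimately have "card ((*) y ` U) \<le> card (b ` F)" using F(1) by (intro conjunct2[OF independent_span_bound]) auto
    then show ?thesis using yi by (simp add: card_image)
  qed
  then show ?thesis using that by blast
qed

end

subsection \<open>Matrix units\<close>

text \<open>An orthonormal basis of A e. Completeness is expressed through the operator z = sum of
  u_i u_i^*, which must act as the identity on A e.\<close>

definition frame :: "'a \<Rightarrow> nat \<Rightarrow> (nat \<Rightarrow> 'a) \<Rightarrow> bool" where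
  "frame e n u \<longleftrightarrow> (\<forall>i<n. u i * e = u i) \<and> (\<forall>i<n. \<forall>j<n. star (u i) * u j = (if i = j then e else 0)) \<and>
     (\<forall>v. v * e = v \<longrightarrow> (\<Sum>i<n. u i * star (u i)) * v = v)"

text \<open>An orthonormal set of maximal size is complete: a nonzero remainder could be normalized
  and adjoined.\<close>

lemma frame_exists:
  assumes ann: left_annihilator_property and e: "minproj e"
  obtains n u where "frame e n u"
proof -
  note es = minproj_simps[OF e]
  obtain N where N: "\<And>U. orthonormal e U \<Longrightarrow> card U \<le> N" using orthonormal_card_bound[OF e ann] by blast
  have "orthonormal e {}" by (simp add: orthonormal_def[OF e])
  then obtain U where U: "orthonormal e U" and max: "\<And>V. orthonormal e V \<Longrightarrow> card V \<le> card U"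
    using ex_has_greatest_nat[of "orthonormal e" "{}" card "Suc N"] N by (auto simp: less_Suc_eq_le)
  have fin: "finite U" and Ue: "\<And>u. u \<in> U \<Longrightarrow> u * e = u" 
    and orth: "\<And>u v. u \<in> U \<Longrightarrow> v \<in> U \<Longrightarrow> star u * v = (if u = v then e else 0)"
    using U by (auto simp: orthonormal_def[OF e])
  have complete: "(\<Sum>u\<in>U. u * star u) * v = v" if v: "v * e = v" for v
  proof (rule ccontr)
    define w where "w = v - (\<Sum>u\<in>U. u * star u) * v"
    assume "(\<Sum>u\<in>U. u * star u) * v \<noteq> v"
    then have "w \<noteq> 0" by (auto simp: w_def)
    have we: "w * e = w" using v by (simp add: w_def left_diff_distrib mult.assoc)
    have uw: "star u * w = 0" if u: "u \<in> U" for u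
    proof -
      have "star u * (\<Sum>x\<in>U. x * star x) = (\<Sum>x\<in>U. (star u * x) * star x)"
        by (simp add: sum_distrib_left mult.assoc)
      also have "\<dots> = (\<Sum>x\<in>U. if u = x then e * star x else 0)" using orth u by (intro sum.cong) auto
      also have "\<dots> = star (u * e)" using fin u es(1) by simp
      finally have "star u * (\<Sum>x\<in>U. x * star x) = star u" using Ue[OF u] by simp
      then show ?thesis by (simp add: w_def right_diff_distrib mult.assoc[symmetric])
    qed
    obtain c where c: "c \<noteq> 0" "star (smul c w) * smul c w = e" using minproj_normalize[OF e we \<open>w \<noteq> 0\<close>] by blast
    have wu: "star w * u = 0" if "u \<in> U" for u using arg_cong[OF uw[OF that], of star] by simp
    have "smul c w \<notin> U"
    proof
      assume "smul c w \<in> U"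
      then have "star (smul c w) * smul c w = 0" using uw by (metis mult_smul_right scale_zero_right)
      then show False using c(2) es(3) by auto
    qed
    moreover have "orthonormal e (insert (smul c w) U)"
      unfolding orthonormal_def[OF e] using fin Ue orth uw wu c(2) we \<open>smul c w \<notin> U\<close> by auto
    ultimately show False using max[of "insert (smul c w) U"] fin by simp
  qed
  obtain h where h: "bij_betw h {..<card U} U" using ex_bij_betw_nat_finite[OF fin] by (auto simp: atLeast0LessThan)
  have "(\<Sum>i<card U. h i * star (h i)) = (\<Sum>u\<in>U. u * star u)"
    by (rule sum.reindex_bij_betw[OF h])
  moreover have "h i \<in> U" if "i < card U" for i using h that by (auto simp: bij_betw_def)
  moreover have "h i = h j \<longleftrightarrow> i = j" if "i < card U" "j < card U" for i j 
    using h that by (auto simp: bij_betw_def inj_on_def)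
  ultimately have "frame e (card U) h" unfolding frame_def using complete Ue orth by simp
  then show ?thesis using that by blast
qed

context
  fixes e n u z
  assumes e: "minproj e" and fr: "frame e n u" and z: "z = (\<Sum>i<n. u i * star (u i))"
begin

lemma frame_simps: 
  "i < n \<Longrightarrow> u i * e = u i" "i < n \<Longrightarrow> j < n \<Longrightarrow> star (u i) * u j = (if i = j then e else 0)"
  "v * e = v \<Longrightarrow> z * v = v"
  using fr by (auto simp: frame_def z)

lemma frame_star: "star z = z"
  by (simp add: z)

text \<open>Since a u_i lies in A e, z fixes it, and so z a z = a z. Taking adjoints gives z a z = z
  a.\<close>

lemma frame_central: "a * z = z * a"
proof -
  have az: "z * (a * z) = a * z" for a
  proof -
    have "z * (a * (u i * star (u i))) = a * (u i * star (u i))" if "i < n" for i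
      using frame_simps(3)[of "a * u i"] frame_simps(1)[OF that] by (simp add: mult.assoc) (simp add: mult.assoc[symmetric])
    then show ?thesis by (subst (2 3) z) (simp add: sum_distrib_left)
  qed
  have "star (z * (star a * z)) = star (star a * z)" using az[of "star a"] by simp
  then have "z * a * z = z * a" using frame_star by simp
  then show ?thesis using az[of a] by (simp add: mult.assoc)
qed

lemma frame_zu: "i < n \<Longrightarrow> z * u i = u i"
  using frame_simps(1,3) by simp

lemma frame_ze: "z * e = e"
  using frame_simps(3) minproj_simps(2)[OF e] by simp

lemma frame_idem: "z * z = z"
  by (subst (2 3) z) (simp add: sum_distrib_left mult.assoc[symmetric] frame_zu)

lemma frame_pos: "1 \<le> n"
proof (rule ccontr)
  assume "\<not> 1 \<le> n"
  then have "n = 0" by simp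
  then have "z = 0" using z by simp
  then show False using frame_ze minproj_simps(3)[OF e] by simp
qed

lemma frame_coeff: "i < n \<Longrightarrow> j < n \<Longrightarrow> \<exists>c. star (u i) * a * u j = smul c e"
  using minproj_form[OF e, of "u i" "a * u j"] frame_simps(1) by (metis mult.assoc)

text \<open>A central idempotent w acts on e, hence on every u_i and on z, as one scalar l with l^2
  = l. So z is a minimal central projection.\<close>

lemma frame_central_mult:
  assumes "\<And>a. a * w = w * a" "w * w = w"
  shows "w * z = 0 \<or> w * z = z"
proof -
  obtain l where "e * w * e = smul l e" using e unfolding minproj_def by blast
  then have we: "w * e = smul l e" using assms(1)[of e] minproj_simps(2)[OF e] by (metis mult.assoc)
  have "w * (w * e) = w * e" using assms(2) by (simp add: mult.assoc[symmetric])
  then have "smul (l * l) e = smul l e" using we by simp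
  then have "l * l = l" using minproj_simps(3)[OF e] unfolding scale_cancel_right by blast
  then have l: "l = 0 \<or> l = 1" by auto
  have "w * u i = smul l (u i)" if "i < n" for i
    using assms(1)[of "u i"] we frame_simps(1)[OF that] by (metis mult.assoc mult_smul_right)
  then have "w * z = smul l z" 
    by (simp add: z sum_distrib_left scale_sum_right mult.assoc[symmetric])
  then show ?thesis using l by auto
qed

end

text \<open>By \<open>frame_central_mult\<close> in both directions, z z' is 0 or z and also 0 or
  z'.\<close>

lemma frame_disjoint:
  assumes "minproj e" "frame e n u" "z = (\<Sum>i<n. u i * star (u i))"
    and "minproj e'" "frame e' n' u'" "z' = (\<Sum>i<n'. u' i * star (u' i))" "z \<noteq> z'"
  shows "z * z' = 0"
  using frame_central_mult[OF assms(1-3), of z'] frame_central_mult[OF assms(4-6), of z]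
    frame_central[OF assms(1-3)] frame_central[OF assms(4-6)] frame_idem[OF assms(1-3)] frame_idem[OF assms(4-6)]
    assms(7) by metis

end

section \<open>The entrywise topology on matrices\<close>

lemma continuous_map_euclidean_matrix:
  fixes g :: "'b \<Rightarrow> nat \<Rightarrow> nat \<Rightarrow> complex"
  assumes "\<And>i j. continuous_map T euclidean (\<lambda>a. g a i j)"
  shows "continuous_map T euclidean g"
proof -
  have "continuous_map T euclidean (\<lambda>a. g a i)" for i
    using assms continuous_map_componentwise_UNIV[of T "\<lambda>_. euclidean" "\<lambda>a. g a i"]
    by (simp add: euclidean_product_topology)
  then show ?thesis
    using continuous_map_componentwise_UNIV[of T "\<lambda>_. euclidean" g] by (simp add: euclidean_product_topology)
qed

lemma open_matrix_ball:
  fixes b :: "nat \<Rightarrow> nat \<Rightarrow> complex"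
  shows "open {m. \<forall>i<n. \<forall>j<n. cmod (m i j - b i j) < d}"
proof -
  have "open {m :: nat \<Rightarrow> nat \<Rightarrow> complex. cmod (m i j - b i j) < d}" for i j
  proof -
    have "continuous_on UNIV (\<lambda>m :: nat \<Rightarrow> nat \<Rightarrow> complex. m i j)"
      by (rule continuous_on_product_then_coordinatewise[OF continuous_on_product_coordinates])
    then have "continuous_on UNIV (\<lambda>m :: nat \<Rightarrow> nat \<Rightarrow> complex. cmod (m i j - b i j))"
      by (rule continuous_on_norm[OF continuous_on_diff[OF _ continuous_on_const]])
    then show ?thesis by (rule open_Collect_less[OF _ continuous_on_const])
  qed
  then have "open (\<Inter>i\<in>{..<n}. \<Inter>j\<in>{..<n}. {m :: nat \<Rightarrow> nat \<Rightarrow> complex. cmod (m i j - b i j) < d})"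
    by (intro open_INT) auto
  moreover have "(\<Inter>i\<in>{..<n}. \<Inter>j\<in>{..<n}. {m :: nat \<Rightarrow> nat \<Rightarrow> complex. cmod (m i j - b i j) < d})
     = {m. \<forall>i<n. \<forall>j<n. cmod (m i j - b i j) < d}" by auto
  ultimately show ?thesis by simp
qed

section \<open>Matrix coordinates given by the minimal central projections\<close>

context lcs_algebra
begin

text \<open>The central projections index themselves; \<open>E\<close>, \<open>N\<close> and
  \<open>U\<close> attach to each of them a minimal projection, a size and an orthonormal basis.
  \<open>I_complete\<close> puts every minimal projection under a member of
  \<open>I\<close>.\<close>

context
  fixes I :: "'a set" and E :: "'a \<Rightarrow> 'a" and N :: "'a \<Rightarrow> nat" and U :: "'a \<Rightarrow> nat \<Rightarrow> 'a"
  assumes ann: left_annihilator_property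
    and IE: "\<And>z. z \<in> I \<Longrightarrow> minproj (E z)"
    and IF: "\<And>z. z \<in> I \<Longrightarrow> frame (E z) (N z) (U z)"
    and Iz: "\<And>z. z \<in> I \<Longrightarrow> z = (\<Sum>i<N z. U z i * star (U z i))"
    and I_complete: "\<And>e. minproj e \<Longrightarrow> \<exists>z\<in>I. z * e = e"
begin

context
  fixes z assumes z: "z \<in> I"
begin

lemmas I_central = frame_central[OF IE[OF z] IF[OF z] Iz[OF z]]
  and I_idem = frame_idem[OF IE[OF z] IF[OF z] Iz[OF z]]
  and I_zu = frame_zu[OF IE[OF z] IF[OF z] Iz[OF z]]
  and I_coeff = frame_coeff[OF IE[OF z] IF[OF z] Iz[OF z]]
  and I_orth = frame_simps(2)[OF IE[OF z] IF[OF z] Iz[OF z]]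
  and I_ue = frame_simps(1)[OF IE[OF z] IF[OF z] Iz[OF z]]
  and I_star = frame_star[OF IE[OF z] IF[OF z] Iz[OF z]]

lemma I_uz: "i < N z \<Longrightarrow> star (U z i) * z = star (U z i)"
  using arg_cong[OF I_zu, of i star] I_star by simp

lemma I_disjoint: "z' \<in> I \<Longrightarrow> z \<noteq> z' \<Longrightarrow> z * z' = 0"
  using frame_disjoint[OF IE[OF z] IF[OF z] Iz[OF z] IE IF Iz] by blast

end

text \<open>For i, j < \<open>N z\<close> the scalar exists by \<open>I_coeff\<close> and is unique
  because \<open>E z\<close> is nonzero; \<open>coef_map\<close> puts 0 at all other
  indices.\<close>

definition coef :: "'a \<Rightarrow> nat \<Rightarrow> nat \<Rightarrow> 'a \<Rightarrow> complex" where
  "coef z i j a = (SOME c. star (U z i) * a * U z j = smul c (E z))"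

lemma coef: "z \<in> I \<Longrightarrow> i < N z \<Longrightarrow> j < N z \<Longrightarrow> star (U z i) * a * U z j = smul (coef z i j a) (E z)"
  unfolding coef_def by (rule someI_ex, rule I_coeff) auto

lemma coef_unique: 
  assumes "z \<in> I" "i < N z" "j < N z" "star (U z i) * a * U z j = smul c (E z)" shows "coef z i j a = c"
  using coef[OF assms(1-3), of a] assms(4) minproj_simps(3)[OF IE[OF assms(1)]] by simp

lemma coef_add: 
  "z \<in> I \<Longrightarrow> i < N z \<Longrightarrow> j < N z \<Longrightarrow> coef z i j (a + b) = coef z i j a + coef z i j b"
  by (rule coef_unique) (simp_all add: distrib_left distrib_right scale_left_distrib coef)

lemma coef_smul: "z \<in> I \<Longrightarrow> i < N z \<Longrightarrow> j < N z \<Longrightarrow> coef z i j (smul c a) = c * coef z i j a"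
  by (rule coef_unique) (simp_all add: coef)

lemma coef_diff: 
  "z \<in> I \<Longrightarrow> i < N z \<Longrightarrow> j < N z \<Longrightarrow> coef z i j (a - b) = coef z i j a - coef z i j b"
  using coef_add[of z i j a "smul (-1) b"] coef_smul[of z i j "-1" b] by simp

lemma coef_star:
  assumes "z \<in> I" "i < N z" "j < N z" shows "coef z i j (star a) = cnj (coef z j i a)"
proof (rule coef_unique[OF assms])
  show "star (U z i) * star a * U z j = smul (cnj (coef z j i a)) (E z)"
    using arg_cong[OF coef[OF assms(1,3,2), of a], of star] minproj_simps(1)[OF IE[OF assms(1)]]
    by (simp add: mult.assoc)
qed

text \<open>Insert z next to \<open>star (U z i)\<close>, which it fixes, move it between a and b by
  centrality, and expand it as the sum of u_k u_k^*.\<close>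

lemma coef_mult:
  assumes z: "z \<in> I" and ij: "i < N z" "j < N z" 
  shows "coef z i j (a * b) = (\<Sum>k<N z. coef z i k a * coef z k j b)"
proof (rule coef_unique[OF assms])
  have "star (U z i) * (a * b) * U z j = star (U z i) * z * a * b * U z j"
    using I_uz[OF z ij(1)] by (simp add: mult.assoc)
  also have "\<dots> = star (U z i) * a * z * b * U z j"
    using I_central[OF z, of a] by (simp add: mult.assoc)
  also have "\<dots> = star (U z i) * a * (\<Sum>k<N z. U z k * star (U z k)) * b * U z j"
    by (rule arg_cong[OF Iz[OF z], of "\<lambda>t. star (U z i) * a * t * b * U z j"])
  also have "\<dots> = (\<Sum>k<N z. (star (U z i) * a * U z k) * (star (U z k) * b * U z j))"
    by (simp add: sum_distrib_left sum_distrib_right mult.assoc)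
  also have "\<dots> = (\<Sum>k<N z. smul (coef z i k a) (E z) * smul (coef z k j b) (E z))"
    using z ij by (intro sum.cong) (auto simp: coef)
  also have "\<dots> = smul (\<Sum>k<N z. coef z i k a * coef z k j b) (E z)"
    using minproj_simps(2)[OF IE[OF z]] by (simp add: scale_sum_left mult.commute)
  finally show "star (U z i) * (a * b) * U z j = smul (\<Sum>k<N z. coef z i k a * coef z k j b) (E z)" .
qed

text \<open>The elements u_i u_j^* are the matrix units of z A; expand both factors z in z a = z a
  z.\<close>

lemma I_mult_expand:
  assumes z: "z \<in> I"
  shows "z * a = (\<Sum>i<N z. \<Sum>j<N z. smul (coef z i j a) (U z i * star (U z j)))"
proof -
  have "z * a * z = z * (z * a)" using I_central[OF z, of a] by (simp add: mult.assoc)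
  then have "z * a = z * a * z" using I_idem[OF z] by (simp add: mult.assoc[symmetric])
  also have "\<dots> = (\<Sum>i<N z. U z i * star (U z i)) * a * (\<Sum>j<N z. U z j * star (U z j))"
    using Iz[OF z] by simp
  also have "\<dots> = (\<Sum>i<N z. \<Sum>j<N z. U z i * (star (U z i) * a * U z j) * star (U z j))"
    by (simp add: sum_distrib_left sum_distrib_right mult.assoc)
      (rule sum.swap)
  also have "\<dots> = (\<Sum>i<N z. \<Sum>j<N z. smul (coef z i j a) (U z i * star (U z j)))"
    using coef[OF z] I_ue[OF z] by (intro sum.cong) auto
  finally show ?thesis .
qed

text \<open>Approximate 1 at q by a finite sum over F. Each e in F lies under one member of
  \<open>I\<close>; any other z annihilates the whole sum, and \<open>contraction_eq_zero\<close>
  gives q z = 0.\<close>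

lemma finite_support:
  assumes q: "q \<in> Q" shows "finite {z \<in> I. q z \<noteq> 0}"
proof -
  obtain F a where F: "finite F" "\<And>e. e \<in> F \<Longrightarrow> minproj e" "q (1 - (\<Sum>e\<in>F. a e * e)) < 1"
    using socle_approx[OF ann q] by blast
  obtain \<zeta> where \<zeta>: "\<And>e. e \<in> F \<Longrightarrow> \<zeta> e \<in> I" "\<And>e. e \<in> F \<Longrightarrow> \<zeta> e * e = e"
    using I_complete F(2) by metis
  have "z \<in> \<zeta> ` F" if z: "z \<in> I" "q z \<noteq> 0" for z
  proof (rule ccontr)
    assume "z \<notin> \<zeta> ` F"
    have "z * (a e * e) = 0" if e: "e \<in> F" for e
    proof -
      have "z * \<zeta> e = 0" using I_disjoint[OF z(1) \<zeta>(1)[OF e]] \<open>z \<notin> \<zeta> ` F\<close> e by blast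
      then have "z * e = 0" using \<zeta>(2)[OF e] by (metis mult.assoc mult_zero_left)
      moreover have "z * (a e * e) = a e * (z * e)"
        using I_central[OF z(1), of "a e"] by (simp add: mult.assoc[symmetric])
      ultimately show ?thesis by simp
    qed
    then have "z * (\<Sum>e\<in>F. a e * e) = 0" by (simp add: sum_distrib_left)
    then have "q ((\<Sum>e\<in>F. a e * e) * z) = 0"
      using I_central[OF z(1), of "\<Sum>e\<in>F. a e * e"] Q_zero[OF q] by simp
    then show False using contraction_eq_zero[OF q F(3)] z(2) by blast
  qed
  then have "{z \<in> I. q z \<noteq> 0} \<subseteq> \<zeta> ` F" by blast
  then show ?thesis using F(1) finite_surj by blast
qed

lemma mult_sum_central:
  assumes "z \<in> I" "finite A" "A \<subseteq> I" "\<And>z. z \<in> A \<Longrightarrow> z * x z = x z"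
  shows "z * (\<Sum>z\<in>A. x z) = (if z \<in> A then x z else 0)"
proof -
  have "z * x z' = (if z' = z then x z else 0)" if z': "z' \<in> A" for z'
  proof (cases "z' = z")
    case False
    then have "z * z' = 0" using I_disjoint assms(1,3) z' by blast
    then have "z * (z' * x z') = 0" by (simp add: mult.assoc[symmetric])
    then show ?thesis using assms(4)[OF z'] False by simp
  qed (use z' assms(4) in auto)
  then have "z * (\<Sum>z\<in>A. x z) = (\<Sum>z'\<in>A. if z' = z then x z else 0)"
    unfolding sum_distrib_left by (intro sum.cong) auto
  then show ?thesis using assms(2) by simp
qed

text \<open>The complement w of the finitely many z with q z nonzero is q-null. Indeed the left
  ideal of all x with q (x w) = 0 contains every minimal projection, hence an element at q-distance
  less than 1 from 1.\<close>

lemma seminorm_le_sum: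
  assumes q: "q \<in> Q" shows "q a \<le> (\<Sum>z\<in>{z \<in> I. q z \<noteq> 0}. q (z * a))"
proof -
  let ?F = "{z \<in> I. q z \<noteq> 0}"
  define w where "w = 1 - (\<Sum>z\<in>?F. z)"
  have zw: "q (z * w) = 0" if z: "z \<in> I" for z
  proof (cases "z \<in> ?F")
    case True
    then have "z * w = 0"
      using mult_sum_central[OF z finite_support[OF q], of "\<lambda>z. z"] I_idem by (auto simp: w_def right_diff_distrib)
    then show ?thesis using Q_zero[OF q] by simp
  next
    case False
    then show ?thesis using z Q_mult[OF q, of z w] Q_nonneg[OF q, of "z * w"] by simp
  qed
  have null_left: "q (b * x) = 0" if "q x = 0" for b x
    using Q_mult[OF q, of b x] Q_nonneg[OF q, of "b * x"] that by simp
  have "left_ideal smul {x. q (x * w) = 0}"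
    unfolding left_ideal_def
  proof (intro conjI ballI allI)
    fix x assume x: "x \<in> {x. q (x * w) = 0}"
    show "x + y \<in> {x. q (x * w) = 0}" if "y \<in> {x. q (x * w) = 0}" for y
      using x that Q_triangle[OF q, of "x * w" "y * w"] Q_nonneg[OF q, of "x * w + y * w"] by (simp add: distrib_right)
    show "a * x \<in> {x. q (x * w) = 0}" for a using x null_left by (simp add: mult.assoc)
  qed (auto simp: Q_zero[OF q] Q_smul[OF q])
  moreover have "e \<in> {x. q (x * w) = 0}" if "minproj e" for e
  proof -
    obtain z where z: "z \<in> I" "z * e = e" using I_complete[OF \<open>minproj e\<close>] by blast
    then have "e * w = e * (z * w)" using I_central[OF z(1), of e] by (simp add: mult.assoc[symmetric])
    then show ?thesis using null_left[OF zw[OF z(1)]] by simp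
  qed
  ultimately obtain x where "q (x * w) = 0" "q (1 - x) < 1" 
    using left_ideal_with_minprojs_dense[OF ann q, of "{x. q (x * w) = 0}"] by blast
  then have "q w = 0" using contraction_eq_zero[OF q] by blast
  then have "q (w * a) = 0" using Q_mult[OF q, of w a] Q_nonneg[OF q, of "w * a"] by simp
  moreover have "a = w * a + (\<Sum>z\<in>?F. z * a)" by (simp add: w_def left_diff_distrib sum_distrib_right)
  ultimately have "q a \<le> q (\<Sum>z\<in>?F. z * a)" using Q_triangle[OF q, of "w * a" "\<Sum>z\<in>?F. z * a"] by simp
  also have "\<dots> \<le> (\<Sum>z\<in>?F. q (z * a))" by (rule cs_sum_le[OF Q_cs[OF q]])
  finally show ?thesis .
qed

definition coef_map :: "'a \<Rightarrow> 'a \<Rightarrow> nat \<Rightarrow> nat \<Rightarrow> complex" where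
  "coef_map a = (\<lambda>z\<in>I. \<lambda>i j. if i < N z \<and> j < N z then coef z i j a else 0)"

lemma coef_map_in: "coef_map a \<in> (\<Pi>\<^sub>E z\<in>I. mat_carrier (N z))"
  by (auto simp: coef_map_def mat_carrier_def)

text \<open>Finitely many entries control q. This gives both injectivity and openness of
  \<open>coef_map\<close>.\<close>

lemma seminorm_le_coef:
  assumes q: "q \<in> Q"
  shows "q a \<le> (\<Sum>z\<in>{z \<in> I. q z \<noteq> 0}. \<Sum>i<N z. \<Sum>j<N z. cmod (coef z i j a) * q (U z i * star (U z j)))"
proof -
  have "q (z * a) \<le> (\<Sum>i<N z. \<Sum>j<N z. cmod (coef z i j a) * q (U z i * star (U z j)))" if "z \<in> I" for z
    unfolding I_mult_expand[OF that] Q_smul[OF q, symmetric]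
    by (rule order_trans[OF cs_sum_le[OF Q_cs[OF q]]], rule sum_mono, rule cs_sum_le[OF Q_cs[OF q]])
  then have "(\<Sum>z\<in>{z \<in> I. q z \<noteq> 0}. q (z * a)) \<le>
      (\<Sum>z\<in>{z \<in> I. q z \<noteq> 0}. \<Sum>i<N z. \<Sum>j<N z. cmod (coef z i j a) * q (U z i * star (U z j)))"
    by (intro sum_mono) auto
  with seminorm_le_sum[OF q, of a] show ?thesis by (rule order_trans)
qed

lemma inj_coef_map: "inj coef_map"
proof (rule injI)
  fix a b assume eq: "coef_map a = coef_map b"
  have "coef z i j (a - b) = 0" if "z \<in> I" "i < N z" "j < N z" for z i j
    using fun_cong[OF fun_cong[OF fun_cong[OF eq, of z], of i], of j] that 
    by (simp add: coef_map_def coef_diff)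
  then have "q (a - b) \<le> 0" if "q \<in> Q" for q
    using seminorm_le_coef[OF that, of "a - b"] by simp
  then have "a - b = 0" using Q_nonneg by (intro Q_separating) (meson order_antisym)
  then show "a = b" by simp
qed

text \<open>Assemble the prescribed matrices to x z in z A and sum over z. For each q only finitely
  many terms matter, so the net of finite partial sums is Cauchy; its limit a satisfies z a = x
  z.\<close>

lemma coef_map_surj:
  assumes m: "m \<in> (\<Pi>\<^sub>E z\<in>I. mat_carrier (N z))"
  shows "\<exists>a. coef_map a = m"
proof -
  define x where "x = (\<lambda>z. \<Sum>i<N z. \<Sum>j<N z. smul (m z i j) (U z i * star (U z j)))"
  have zx: "z * x z = x z" if "z \<in> I" for z
    using I_zu[OF that] by (simp add: x_def sum_distrib_left mult.assoc[symmetric])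
  have x_null: "q (x z) = 0" if "q \<in> Q" "z \<in> I" "q z = 0" for q z
    using Q_mult[OF that(1), of z "x z"] Q_nonneg[OF that(1), of "x z"] zx[OF that(2)] that(3) by simp
  let ?F = "filtermap (\<lambda>A. \<Sum>z\<in>A. x z) (finite_subsets_at_top I)"
  have "sn_cauchy Q ?F"
    unfolding sn_cauchy_def
  proof (intro conjI ballI allI impI)
    show "?F \<noteq> bot" by (simp add: filtermap_bot_iff)
    fix q e assume q: "q \<in> Q" and e: "(0::real) < e"
    let ?A = "{z \<in> I. q z \<noteq> 0}"
    \<comment> \<open>Terms outside \<open>?A\<close> are q-null, so modulo the kernel of q the net
      is constant from \<open>?A\<close> on.\<close>
    let ?P = "\<lambda>v. q (v - (\<Sum>z\<in>?A. x z)) = 0"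
    have "?P (\<Sum>z\<in>A. x z)" if A: "finite A" "?A \<subseteq> A" "A \<subseteq> I" for A
    proof -
      have "(\<Sum>z\<in>A. x z) - (\<Sum>z\<in>?A. x z) = (\<Sum>z\<in>A - ?A. x z)"
        using sum.subset_diff[OF A(2,1), of x] by simp
      moreover have "q (\<Sum>z\<in>A - ?A. x z) \<le> (\<Sum>z\<in>A - ?A. q (x z))" by (rule cs_sum_le[OF Q_cs[OF q]])
      moreover have "(\<Sum>z\<in>A - ?A. q (x z)) = 0" using x_null[OF q] A(3) by (intro sum.neutral) auto
      ultimately show ?thesis using Q_nonneg[OF q, of "\<Sum>z\<in>A - ?A. x z"] by simp
    qed
    then have "eventually ?P ?F"
      using finite_support[OF q] by (auto simp: eventually_filtermap eventually_finite_subsets_at_top intro!: exI[of _ ?A])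
    moreover have "q (v - v') < e" if "?P v" "?P v'" for v v'
      using cs_diff_triangle[OF Q_cs[OF q], of v v' "\<Sum>z\<in>?A. x z"] 
        cs_diff_commute[OF Q_cs[OF q], of v' "\<Sum>z\<in>?A. x z"] that e by simp
    ultimately show "\<forall>\<^sub>F (v, v') in ?F \<times>\<^sub>F ?F. q (v - v') < e"
      unfolding eventually_prod_same by (intro exI[of _ ?P]) auto
  qed
  then obtain a where a: "sn_converges Q ?F a" using Q_complete unfolding sn_complete_def by blast
  have za: "z * a = x z" if z: "z \<in> I" for z
  proof -
    have "x z - z * a = 0"
    proof (rule Q_separating)
      fix q assume q: "q \<in> Q"
      have "q (x z - z * a) \<le> 0 + e" if e: "e > 0" for e
      proof -
        define d where "d = e / (q z + 1)"
        have "d > 0" using e Q_nonneg[OF q, of z] by (simp add: d_def)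
        have "\<forall>\<^sub>F A in finite_subsets_at_top I. q ((\<Sum>z\<in>A. x z) - a) < d"
          using a q \<open>d > 0\<close> unfolding sn_converges_def eventually_filtermap by blast
        then obtain X where X: "finite X" "X \<subseteq> I" 
           "\<forall>Y. finite Y \<and> X \<subseteq> Y \<and> Y \<subseteq> I \<longrightarrow> q ((\<Sum>z\<in>Y. x z) - a) < d"
          unfolding eventually_finite_subsets_at_top by (elim exE conjE)
        \<comment> \<open>With z in the index set, multiplying the partial sum by z extracts exactly
          x z.\<close>
        let ?Y = "insert z X"
        have "z * (\<Sum>z\<in>?Y. x z) = x z" using mult_sum_central[OF z, of ?Y x] X z zx by auto
        then have "x z - z * a = z * ((\<Sum>z\<in>?Y. x z) - a)" by (simp only: right_diff_distrib)
        then have "q (x z - z * a) \<le> q z * q ((\<Sum>z\<in>?Y. x z) - a)" by (simp only: Q_mult[OF q])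
        also have "q ((\<Sum>z\<in>?Y. x z) - a) < d"
          using X(3)[rule_format, of ?Y] X(1,2) z by blast
        then have "q z * q ((\<Sum>z\<in>?Y. x z) - a) \<le> (q z + 1) * d"
          using Q_nonneg[OF q] by (intro mult_mono) (auto intro: less_imp_le)
        also have "\<dots> = e" using Q_nonneg[OF q, of z] by (simp add: d_def)
        finally show ?thesis by simp
      qed
      then have "q (x z - z * a) \<le> 0" by (rule field_le_epsilon)
      then show "q (x z - z * a) = 0" using Q_nonneg[OF q, of "x z - z * a"] by simp
    qed
    then show ?thesis by simp
  qed
  have "coef z i j a = m z i j" if z: "z \<in> I" and ij: "i < N z" "j < N z" for z i j
  proof (rule coef_unique[OF z ij])
    have "star (U z i) * a * U z j = star (U z i) * x z * U z j"
      using I_uz[OF z ij(1)] unfolding za[OF z, symmetric] by (simp add: mult.assoc[symmetric])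
    also have "\<dots> = (\<Sum>k<N z. \<Sum>l<N z. smul (m z k l) ((star (U z i) * U z k) * (star (U z l) * U z j)))"
      by (simp add: x_def sum_distrib_left sum_distrib_right mult.assoc)
    also have "\<dots> = (\<Sum>k<N z. \<Sum>l<N z. if l = j then if k = i then smul (m z k l) (E z) else 0 else 0)"
      using I_orth[OF z] ij minproj_simps(2)[OF IE[OF z]] by (intro sum.cong) auto
    also have "\<dots> = smul (m z i j) (E z)" using ij by simp
    finally show "star (U z i) * a * U z j = smul (m z i j) (E z)" .
  qed
  moreover have "m z i j = 0" if "z \<in> I" "\<not> (i < N z \<and> j < N z)" for z i j
    using PiE_mem[OF m that(1)] that(2) by (auto simp: mat_carrier_def not_less)
  moreover have "m z = undefined" if "z \<notin> I" for z using m that by (auto simp: PiE_def extensional_def)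
  ultimately have "coef_map a = m" by (auto simp: coef_map_def fun_eq_iff)
  then show ?thesis ..
qed

text \<open>Some q is nonzero at \<open>E z\<close>; dividing by q (\<open>E z\<close>) bounds the
  entry by a multiple of q.\<close>

lemma coef_bounded:
  assumes z: "z \<in> I" and ij: "i < N z" "j < N z"
  obtains q K where "q \<in> Q" "K \<ge> 0" "\<And>a. cmod (coef z i j a) \<le> K * q a"
proof -
  obtain q where q: "q \<in> Q" "q (E z) \<noteq> 0" using Q_separating minproj_simps(3)[OF IE[OF z]] by blast
  have pos: "q (E z) > 0" using Q_nonneg[OF q(1), of "E z"] q(2) by simp
  show ?thesis
  proof
    show "0 \<le> q (star (U z i)) * q (U z j) / q (E z)" using Q_nonneg[OF q(1)] by simp
    fix a
    have "cmod (coef z i j a) * q (E z) = q (star (U z i) * a * U z j)"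
      unfolding coef[OF assms] by (simp add: Q_smul[OF q(1)])
    also have "\<dots> \<le> q (star (U z i) * a) * q (U z j)" by (rule Q_mult[OF q(1)])
    also have "\<dots> \<le> q (star (U z i)) * q a * q (U z j)"
      by (intro mult_right_mono Q_mult[OF q(1)] Q_nonneg[OF q(1)])
    finally show "cmod (coef z i j a) \<le> q (star (U z i)) * q (U z j) / q (E z) * q a"
      using pos by (simp add: field_simps)
  qed (rule q(1))
qed

lemma homeomorphic_coef_map:
  assumes T: "\<And>S. openin T S \<longleftrightarrow> (\<forall>x\<in>S. \<exists>q\<in>Q. \<exists>e>0. {y. q (y - x) < e} \<subseteq> S)"
  shows "homeomorphic_map T (prod_mat_topology I N) coef_map"
proof (rule bijective_open_imp_homeomorphic_map)
  obtain q0 where "q0 \<in> Q" using Q_separating[of 1] by (metis zero_neq_one)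
  then have "openin T UNIV" unfolding T by (auto intro!: bexI[of _ q0] exI[of _ "1::real"])
  then have top: "topspace T = UNIV" using openin_subset by blast
  have top': "topspace (prod_mat_topology I N) = (\<Pi>\<^sub>E z\<in>I. mat_carrier (N z))"
    by (simp add: prod_mat_topology_def)
  show "inj_on coef_map (topspace T)" using inj_coef_map top by simp
  show "coef_map ` topspace T = topspace (prod_mat_topology I N)"
    unfolding top top' using coef_map_in coef_map_surj by blast
  have cc: "continuous_map T euclidean (\<lambda>a. coef z i j a)" if z: "z \<in> I" "i < N z" "j < N z" for z i j
    unfolding continuous_map_def
  proof (intro conjI allI impI)
    fix V :: "complex set" assume "openin euclidean V"
    obtain q K where q: "q \<in> Q" "K \<ge> 0" "\<And>a. cmod (coef z i j a) \<le> K * q a" using coef_bounded[OF z] by blast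
    show "openin T {a \<in> topspace T. coef z i j a \<in> V}"
      unfolding T
    proof
      fix a assume "a \<in> {a \<in> topspace T. coef z i j a \<in> V}"
      then obtain e where e: "e > 0" "ball (coef z i j a) e \<subseteq> V"
        using \<open>openin euclidean V\<close> open_contains_ball[of V] by (auto simp flip: open_openin)
      have "coef z i j b \<in> V" if b: "q (b - a) < e / (K + 1)" for b
      proof -
        have "(K + 1) * q (b - a) < e" using b q(2) by (simp add: field_simps)
        moreover have "cmod (coef z i j b - coef z i j a) \<le> K * q (b - a)"
          using q(3)[of "b - a"] coef_diff[OF z] by simp
        moreover have "q (b - a) \<ge> 0" using Q_nonneg[OF q(1)] .
        ultimately have "cmod (coef z i j b - coef z i j a) < e" by (simp add: distrib_right)
        then show ?thesis using e(2) by (auto simp: dist_norm norm_minus_commute)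
      qed
      then show "\<exists>q\<in>Q. \<exists>e>0. {y. q (y - a) < e} \<subseteq> {a \<in> topspace T. coef z i j a \<in> V}"
        using q(1,2) e(1) top by (intro bexI[of _ q] exI[of _ "e / (K + 1)"]) auto
    qed
  qed simp
  show "continuous_map T (prod_mat_topology I N) coef_map"
    unfolding prod_mat_topology_def continuous_map_componentwise
  proof (intro conjI ballI)
    show "coef_map ` topspace T \<subseteq> extensional I" by (auto simp: coef_map_def)
    fix z assume z: "z \<in> I"
    have "continuous_map T euclidean (\<lambda>a. coef_map a z)"
    proof (rule continuous_map_euclidean_matrix)
      show "continuous_map T euclidean (\<lambda>a. coef_map a z i j)" for i j
        using z cc[OF z, of i j] by (cases "i < N z \<and> j < N z") (auto simp: coef_map_def)
    qed
    then show "continuous_map T (subtopology euclidean (mat_carrier (N z))) (\<lambda>a. coef_map a z)"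
      using coef_map_in z by (auto simp: continuous_map_in_subtopology)
  qed
  show "open_map T (prod_mat_topology I N) coef_map"
    unfolding open_map_def
  proof (intro allI impI)
    fix S assume S: "openin T S"
    show "openin (prod_mat_topology I N) (coef_map ` S)"
      unfolding prod_mat_topology_def openin_product_topology_alt
    proof
      fix m assume "m \<in> coef_map ` S"
      then obtain a where a: "a \<in> S" "m = coef_map a" by blast
      then obtain q e where q: "q \<in> Q" "e > 0" "{y. q (y - a) < e} \<subseteq> S" using S unfolding T by blast
      let ?F = "{z \<in> I. q z \<noteq> 0}"
      \<comment> \<open>K is what \<open>seminorm_le_coef\<close> gives for entries of modulus 1, so
        entries of modulus at most d = e / (K + 1) keep q below e.\<close>
      define K where "K = (\<Sum>z\<in>?F. \<Sum>i<N z. \<Sum>j<N z. q (U z i * star (U z j)))"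
      have K: "K \<ge> 0" unfolding K_def by (intro sum_nonneg Q_nonneg q(1))
      define d where "d = e / (K + 1)"
      have d: "d > 0" "d * K < e" using q(2) K by (auto simp: d_def field_simps)
      \<comment> \<open>Only the finitely many coordinates with q z nonzero are restricted, so this
        is a basic open box of the product topology.\<close>
      define W where "W = (\<lambda>z. if z \<in> ?F then {b \<in> mat_carrier (N z). \<forall>i<N z. \<forall>j<N z. cmod (b i j - m z i j) < d}
         else mat_carrier (N z))"
      have "finite {z \<in> I. W z \<noteq> topspace (subtopology euclidean (mat_carrier (N z)))}"
        by (rule finite_subset[OF _ finite_support[OF q(1)]]) (auto simp: W_def)
      moreover have "openin (subtopology euclidean (mat_carrier (N z))) (W z)" for z
        using open_matrix_ball[of "N z" "m z" d] by (auto simp: W_def openin_open Int_def)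
      moreover have "m \<in> Pi\<^sub>E I W" 
        using coef_map_in[of a] d(1) by (auto simp: W_def PiE_iff a(2))
      moreover have "Pi\<^sub>E I W \<subseteq> coef_map ` S"
      proof
        fix b assume b: "b \<in> Pi\<^sub>E I W"
        moreover have "W z \<subseteq> mat_carrier (N z)" for z by (auto simp: W_def)
        ultimately have "b \<in> (\<Pi>\<^sub>E z\<in>I. mat_carrier (N z))" by (auto simp: PiE_iff)
        then obtain y where y: "coef_map y = b" using coef_map_surj by blast
        have "cmod (coef z i j (y - a)) \<le> d" if "z \<in> ?F" "i < N z" "j < N z" for z i j
        proof -
          have "b z \<in> W z" using b that(1) by blast
          then have "cmod (b z i j - m z i j) < d" using that by (auto simp: W_def)
          then show ?thesis using that unfolding a(2) y[symmetric] by (auto simp: coef_map_def coef_diff)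
        qed
        then have "q (y - a) \<le> (\<Sum>z\<in>?F. \<Sum>i<N z. \<Sum>j<N z. d * q (U z i * star (U z j)))"
          by (intro order_trans[OF seminorm_le_coef[OF q(1)]] sum_mono mult_right_mono Q_nonneg[OF q(1)]) auto
        also have "\<dots> = d * K" by (simp add: K_def sum_distrib_left)
        finally have "y \<in> S" using d(2) q(3) by auto
        then show "b \<in> coef_map ` S" using y by blast
      qed
      ultimately show "\<exists>W. finite {z \<in> I. W z \<noteq> topspace (subtopology euclidean (mat_carrier (N z)))} \<and>
          (\<forall>z\<in>I. openin (subtopology euclidean (mat_carrier (N z))) (W z)) \<and> m \<in> Pi\<^sub>E I W \<and> Pi\<^sub>E I W \<subseteq> coef_map ` S"
        by (intro exI[of _ W]) blast
    qed
  qed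
qed

lemma coef_map_iso:
  assumes "\<And>S. openin (seminorm_topology P) S \<longleftrightarrow> (\<forall>x\<in>S. \<exists>q\<in>Q. \<exists>e>0. {y. q (y - x) < e} \<subseteq> S)"
  shows "top_star_iso_prod_mat smul star P I N coef_map"
  unfolding top_star_iso_prod_mat_def
proof (intro conjI allI)
  show "homeomorphic_map (seminorm_topology P) (prod_mat_topology I N) coef_map"
    by (rule homeomorphic_coef_map[OF assms])
  fix x y c
  show "coef_map (x + y) = (\<lambda>v\<in>I. \<lambda>j k. coef_map x v j k + coef_map y v j k)"
    by (intro ext) (simp add: coef_map_def coef_add)
  show "coef_map (smul c x) = (\<lambda>v\<in>I. \<lambda>j k. c * coef_map x v j k)"
    by (intro ext) (simp add: coef_map_def coef_smul)
  show "coef_map (x * y) = (\<lambda>v\<in>I. mat_mult (N v) (coef_map x v) (coef_map y v))"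
    by (intro ext) (simp add: coef_map_def coef_mult mat_mult_def)
  show "coef_map (star x) = (\<lambda>v\<in>I. mat_adj (N v) (coef_map x v))"
    by (intro ext) (simp add: coef_map_def coef_star mat_adj_def)
qed

end

lemma left_annihilator_imp_product:
  assumes ann: left_annihilator_property
    and T: "\<And>S. openin (seminorm_topology P) S \<longleftrightarrow> (\<forall>x\<in>S. \<exists>q\<in>Q. \<exists>e>0. {y. q (y - x) < e} \<subseteq> S)"
  shows "\<exists>(I::'a set) n f. (\<forall>v\<in>I. 1 \<le> n v) \<and> top_star_iso_prod_mat smul star P I n f"
proof -
  \<comment> \<open>Different e and u may yield the same z. The set holds each z once, and the
    choice function t then selects the data for it.\<close>
  define I where "I = {z. \<exists>e n u. minproj e \<and> frame e n u \<and> z = (\<Sum>i<n. u i * star (u i))}"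
  have "\<forall>z\<in>I. \<exists>t. minproj (fst t) \<and> frame (fst t) (fst (snd t)) (snd (snd t)) \<and>
      z = (\<Sum>i<fst (snd t). snd (snd t) i * star (snd (snd t) i))"
    by (auto simp: I_def)
  from bchoice[OF this] obtain t where t: "\<forall>z\<in>I. minproj (fst (t z)) \<and>
      frame (fst (t z)) (fst (snd (t z))) (snd (snd (t z))) \<and>
      z = (\<Sum>i<fst (snd (t z)). snd (snd (t z)) i * star (snd (snd (t z)) i))" ..
  define E N U where "E = (\<lambda>z. fst (t z))" and "N = (\<lambda>z. fst (snd (t z)))" and "U = (\<lambda>z. snd (snd (t z)))"
  have IE: "minproj (E z)" and IF: "frame (E z) (N z) (U z)" 
    and Iz: "z = (\<Sum>i<N z. U z i * star (U z i))" if "z \<in> I" for z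
    using bspec[OF t that] unfolding E_def N_def U_def by blast+
  have complete: "\<exists>z\<in>I. z * e = e" if e: "minproj e" for e
  proof -
    obtain n u where fr: "frame e n u" using frame_exists[OF ann e] by blast
    let ?z = "\<Sum>i<n. u i * star (u i)"
    have "?z \<in> I" using e fr by (auto simp: I_def)
    moreover have "?z * e = e" by (rule frame_ze[OF e fr refl])
    ultimately show ?thesis by blast
  qed
  have "top_star_iso_prod_mat smul star P I N (coef_map I E N U)"
    by (rule coef_map_iso[OF ann IE IF Iz complete T])
  moreover have "\<forall>v\<in>I. 1 \<le> N v" using frame_pos[OF IE IF Iz] by blast
  ultimately show ?thesis by blast
qed

end

subsection \<open>Products of matrix algebras\<close>

text \<open>Extend a basis B of W by x and prescribe 0 on B and 1 at x.\<close>

lemma (in vector_space) exists_separating_functional: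
  assumes "subspace W" "x \<notin> W"
  obtains \<phi> where "Vector_Spaces.linear scale (*) \<phi>" "\<And>w. w \<in> W \<Longrightarrow> \<phi> w = 0" "\<phi> x = 1"
proof -
  interpret field: vector_space "(*) :: 'a \<Rightarrow> 'a \<Rightarrow> 'a"
    by unfold_locales (auto simp: algebra_simps)
  interpret pair: vector_space_pair scale "(*) :: 'a \<Rightarrow> 'a \<Rightarrow> 'a" ..
  obtain B where B: "B \<subseteq> W" "independent B" "W \<subseteq> span B" using maximal_independent_subset by blast
  have "x \<notin> span B" using assms span_minimal[OF B(1)] by blast
  then have ind: "independent (insert x B)" and "x \<notin> B" using B(2) span_base by (auto simp: independent_insertI)
  let ?\<phi> = "pair.construct (insert x B) (\<lambda>b. if b = x then 1 else 0)"
  have lin: "Vector_Spaces.linear scale (*) ?\<phi>" by (rule pair.linear_construct[OF ind])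
  have "?\<phi> b = 0" if "b \<in> B" for b using pair.construct_basis[OF ind, of b] that \<open>x \<notin> B\<close> by auto
  then have "?\<phi> w = 0" if "w \<in> W" for w using pair.linear_eq_0_on_span[OF lin, of B] B(3) that by blast
  moreover have "?\<phi> x = 1" using pair.construct_basis[OF ind, of x] by simp
  ultimately show ?thesis using that lin by blast
qed

text \<open>The entries of b are the values, at the unit vectors, of a functional that vanishes on W
  but not at the k-th unit vector. By the support condition every w in W is a finite combination of
  unit vectors.\<close>

lemma exists_annihilating_vector:
  fixes W :: "(nat \<Rightarrow> complex) set"
  assumes W: "(\<lambda>_. 0) \<in> W" "\<And>v w. v \<in> W \<Longrightarrow> w \<in> W \<Longrightarrow> (\<lambda>l. v l + w l) \<in> W" 
      "\<And>c w. w \<in> W \<Longrightarrow> (\<lambda>l. c * w l) \<in> W" 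
    and supp: "\<And>w l. w \<in> W \<Longrightarrow> n \<le> l \<Longrightarrow> w l = 0"
    and k: "(\<lambda>l. if l = k then 1 else 0) \<notin> W"
  obtains b where "b k = 1" "\<And>w. w \<in> W \<Longrightarrow> (\<Sum>l<n. w l * b l) = 0"
proof -
  define sc :: "complex \<Rightarrow> (nat \<Rightarrow> complex) \<Rightarrow> nat \<Rightarrow> complex" where "sc = (\<lambda>c w l. c * w l)"
  interpret vector_space sc by unfold_locales (auto simp: sc_def algebra_simps fun_eq_iff)
  let ?e = "\<lambda>i l. if l = i then 1 else 0 :: complex"
  have "subspace W" unfolding subspace_def using W by (auto simp: sc_def zero_fun_def plus_fun_def)
  then obtain \<phi> where \<phi>: "Vector_Spaces.linear sc (*) \<phi>" "\<And>w. w \<in> W \<Longrightarrow> \<phi> w = 0" "\<phi> (?e k) = 1"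
    using exists_separating_functional k by blast
  interpret Vector_Spaces.linear sc "(*)" \<phi> by (rule \<phi>(1))
  have "(\<Sum>l<n. w l * \<phi> (?e l)) = 0" if w: "w \<in> W" for w
  proof -
    have "(\<Sum>i<n. sc (w i) (?e i)) = w"
    proof
      fix l
      have "(\<Sum>i<n. sc (w i) (?e i)) l = (\<Sum>i<n. sc (w i) (?e i) l)" by (induction n) auto
      also have "\<dots> = (\<Sum>i<n. if l = i then w i else 0)" by (intro sum.cong) (auto simp: sc_def)
      also have "\<dots> = w l" using supp[OF w, of l] by (simp add: not_less)
      finally show "(\<Sum>i<n. sc (w i) (?e i)) l = w l" .
    qed
    then have "\<phi> (\<Sum>i<n. sc (w i) (?e i)) = 0" using \<phi>(2)[OF w] by simp
    then show ?thesis by (simp add: sum scale)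
  qed
  then show ?thesis using that[of "\<lambda>l. \<phi> (?e l)"] \<phi>(3) by blast
qed

definition mat_unit :: "nat \<Rightarrow> nat \<Rightarrow> nat \<Rightarrow> nat \<Rightarrow> complex" where
  "mat_unit j k = (\<lambda>i l. if i = j \<and> l = k then 1 else 0)"

lemma mat_mult_unit_left: 
  assumes "j < m" "k < m" "a \<in> mat_carrier m"
  shows "mat_mult m (mat_unit j k) a = (\<lambda>i l. if i = j then a k l else 0)"
proof (intro ext)
  fix i l
  have "(\<Sum>r<m. mat_unit j k i r * a r l) = (\<Sum>r<m. if r = k then (if i = j then a k l else 0) else 0)"
    by (intro sum.cong) (auto simp: mat_unit_def)
  then show "mat_mult m (mat_unit j k) a i l = (if i = j then a k l else 0)"
    using assms by (auto simp: mat_mult_def mat_carrier_def not_less)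
qed

text \<open>Partial identities: an induction on h adds one diagonal matrix unit at a time until h =
  m gives the identity of size m.\<close>

definition mat_diag :: "nat \<Rightarrow> nat \<Rightarrow> nat \<Rightarrow> complex" where
  "mat_diag h = (\<lambda>i l. if i = l \<and> i < h then 1 else 0)"

lemma mat_mult_diag: 
  assumes "a \<in> mat_carrier m" shows "mat_mult m a (mat_diag m) = a"
proof (intro ext)
  fix i l
  have "(\<Sum>r<m. a i r * mat_diag m r l) = (\<Sum>r<m. if r = l then a i l else 0)"
    by (intro sum.cong) (auto simp: mat_diag_def)
  then show "mat_mult m a (mat_diag m) i l = a i l"
    using assms by (auto simp: mat_mult_def mat_carrier_def not_less)
qed

lemma mat_mult_zero [simp]: 
  "mat_mult m a (\<lambda>_ _. 0) = (\<lambda>_ _. 0)" "mat_mult m (\<lambda>_ _. 0) a = (\<lambda>_ _. 0)"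
  by (auto simp: mat_mult_def fun_eq_iff)

section \<open>Closed ideals in the seminorm topology, and the converse direction\<close>

context lcs_algebra
begin

context
  fixes P :: "('a \<Rightarrow> real) set"
  assumes T: "\<And>S. openin (seminorm_topology P) S \<longleftrightarrow> (\<forall>x\<in>S. \<exists>q\<in>Q. \<exists>e>0. {y. q (y - x) < e} \<subseteq> S)"
begin

lemma topspace_seminorm_topology: "topspace (seminorm_topology P) = UNIV"
proof -
  obtain q0 where "q0 \<in> Q" using Q_separating[of 1] by (metis zero_neq_one)
  then have "openin (seminorm_topology P) UNIV" unfolding T by (auto intro!: bexI[of _ q0] exI[of _ "1::real"])
  then show ?thesis using openin_subset by blast
qed

lemma closedin_iff: 
  "closedin (seminorm_topology P) J \<longleftrightarrow> (\<forall>x. x \<notin> J \<longrightarrow> (\<exists>q\<in>Q. \<exists>e>0. \<forall>y\<in>J. e \<le> q (x - y)))"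
proof -
  have "{y. q (y - x) < e} \<subseteq> - J \<longleftrightarrow> (\<forall>y\<in>J. e \<le> q (x - y))" if "q \<in> Q" for q x e
    using cs_diff_commute[OF Q_cs[OF that], of x] by (auto simp: not_less[symmetric])
  then show ?thesis
    by (auto simp: closedin_def topspace_seminorm_topology T Compl_eq_Diff_UNIV[symmetric])
qed

lemma annihilator_algebra_imp_left:
  assumes "annihilator_algebra smul P" shows left_annihilator_property
  unfolding left_annihilator_property_def closedin_iff[symmetric]
proof (intro allI impI)
  fix J assume "left_ideal smul J" "closedin (seminorm_topology P) J" "J \<noteq> UNIV"
  then have "ran J \<noteq> {0}" using assms unfolding annihilator_algebra_def by blast
  moreover have "0 \<in> ran J" by (simp add: ran_def)
  ultimately obtain a where "a \<in> ran J" "a \<noteq> 0" by blast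
  then show "\<exists>a. a \<noteq> 0 \<and> (\<forall>s\<in>J. s * a = 0)" by (auto simp: ran_def)
qed

text \<open>The involution is isometric for every q, so it carries closed right ideals to closed
  left ideals and right annihilators to left annihilators.\<close>

lemma left_imp_annihilator_algebra:
  assumes left_annihilator_property shows "annihilator_algebra smul P"
proof -
  have left: "\<exists>a. a \<noteq> 0 \<and> (\<forall>s\<in>J. s * a = 0)" 
    if "left_ideal smul J" "closedin (seminorm_topology P) J" "J \<noteq> UNIV" for J
    using assms that unfolding left_annihilator_property_def closedin_iff[symmetric] by blast
  show ?thesis
    unfolding annihilator_algebra_def
  proof (intro conjI allI impI; elim conjE)
    fix J assume "left_ideal smul J" "closedin (seminorm_topology P) J"
    then show "ran J = {0} \<longleftrightarrow> J = UNIV"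
      using left[of J] by (auto simp: ran_def) (metis mult_1_left)
  next
    fix K assume K: "right_ideal smul K" "closedin (seminorm_topology P) K"
    have "lan K \<noteq> {0}" if "K \<noteq> UNIV"
    proof -
      let ?J = "star -` K"
      have "left_ideal smul ?J" using K(1) by (auto simp: left_ideal_def right_ideal_def)
      moreover have "closedin (seminorm_topology P) ?J"
        unfolding closedin_iff
      proof (intro allI impI)
        fix x assume "x \<notin> ?J"
        then obtain q e where q: "q \<in> Q" "e > 0" "\<forall>y\<in>K. e \<le> q (star x - y)" using K(2) unfolding closedin_iff by auto
        moreover have "q (star x - star y) = q (x - y)" for y using Q_star[OF q(1), of "x - y"] by simp
        ultimately show "\<exists>q\<in>Q. \<exists>e>0. \<forall>y\<in>?J. e \<le> q (x - y)" by (metis vimageD)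
      qed
      moreover have "?J \<noteq> UNIV" using that by (metis UNIV_eq_I UNIV_I star_star vimageD)
      ultimately obtain a where a: "a \<noteq> 0" "\<forall>s\<in>?J. s * a = 0" using left by blast
      have "star a * s = 0" if "s \<in> K" for s
      proof -
        have "star s * a = 0" using a(2) that by simp
        then have "star (star s * a) = 0" by simp
        then show ?thesis by simp
      qed
      then have "star a \<in> lan K" by (simp add: lan_def)
      moreover have "star a \<noteq> 0" using a(1) star_star star_zero by metis
      ultimately show ?thesis by blast
    qed
    moreover have "lan UNIV = {0::'a}" by (auto simp: lan_def) (metis mult_1_right)
    ultimately show "lan K = {0} \<longleftrightarrow> K = UNIV" by blast
  qed
qed

context
  fixes I :: "'i set" and n :: "'i \<Rightarrow> nat" and f :: "'a \<Rightarrow> 'i \<Rightarrow> nat \<Rightarrow> nat \<Rightarrow> complex"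
  assumes n_pos: "\<And>v. v \<in> I \<Longrightarrow> 1 \<le> n v" and iso: "top_star_iso_prod_mat smul star P I n f"
begin

lemma iso_homeomorphic: "homeomorphic_map (seminorm_topology P) (prod_mat_topology I n) f"
  and iso_add: "f (x + y) = (\<lambda>v\<in>I. \<lambda>j k. f x v j k + f y v j k)"
  and iso_smul: "f (smul c x) = (\<lambda>v\<in>I. \<lambda>j k. c * f x v j k)"
  and iso_mult: "f (x * y) = (\<lambda>v\<in>I. mat_mult (n v) (f x v) (f y v))"
  using iso unfolding top_star_iso_prod_mat_def by auto

lemma iso_inj: "inj f"
  using homeomorphic_imp_injective_map[OF iso_homeomorphic] topspace_seminorm_topology by simp

lemma iso_range: "range f = (\<Pi>\<^sub>E v\<in>I. mat_carrier (n v))"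
  using homeomorphic_imp_surjective_map[OF iso_homeomorphic] topspace_seminorm_topology 
  by (simp add: prod_mat_topology_def)

lemma iso_carrier: "v \<in> I \<Longrightarrow> f x v \<in> mat_carrier (n v)"
  using iso_range by (metis PiE_mem rangeI)

definition sngl :: "'i \<Rightarrow> (nat \<Rightarrow> nat \<Rightarrow> complex) \<Rightarrow> 'a" where
  "sngl v m = inv f (\<lambda>w\<in>I. if w = v then m else (\<lambda>_ _. 0))"

lemma f_sngl: "m \<in> mat_carrier (n v) \<Longrightarrow> f (sngl v m) = (\<lambda>w\<in>I. if w = v then m else (\<lambda>_ _. 0))"
  unfolding sngl_def by (rule f_inv_into_f) (auto simp: iso_range mat_carrier_def)

lemma sngl_eqI: 
  assumes "m \<in> mat_carrier (n v)" "f x = (\<lambda>w\<in>I. if w = v then m else (\<lambda>_ _. 0))" shows "x = sngl v m"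
  using injD[OF iso_inj, of x "sngl v m"] f_sngl[OF assms(1)] assms(2) by simp

lemma mat_mult_carrier: "mat_mult m a b \<in> mat_carrier m"
  by (auto simp: mat_mult_def mat_carrier_def)

lemma mult_sngl: "v \<in> I \<Longrightarrow> m \<in> mat_carrier (n v) \<Longrightarrow> x * sngl v m = sngl v (mat_mult (n v) (f x v) m)"
  by (rule sngl_eqI[OF mat_mult_carrier]) (auto simp: iso_mult f_sngl restrict_def fun_eq_iff)

lemma sngl_mult: "v \<in> I \<Longrightarrow> m \<in> mat_carrier (n v) \<Longrightarrow> sngl v m * x = sngl v (mat_mult (n v) m (f x v))"
  by (rule sngl_eqI[OF mat_mult_carrier]) (auto simp: iso_mult f_sngl restrict_def fun_eq_iff)

lemma sngl_add: 
  assumes "m \<in> mat_carrier (n v)" "m' \<in> mat_carrier (n v)" 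
  shows "sngl v m + sngl v m' = sngl v (\<lambda>j k. m j k + m' j k)"
  by (rule sngl_eqI) (use assms in \<open>auto simp: mat_carrier_def iso_add f_sngl restrict_def fun_eq_iff\<close>)

lemma sngl_smul: 
  assumes "m \<in> mat_carrier (n v)" shows "smul c (sngl v m) = sngl v (\<lambda>j k. c * m j k)"
  by (rule sngl_eqI) (use assms in \<open>auto simp: mat_carrier_def iso_smul f_sngl restrict_def fun_eq_iff\<close>)

lemma sngl_zero: "sngl v (\<lambda>_ _. 0) = 0"
  using sngl_smul[of "\<lambda>_ _. 0" v 0] by (simp add: mat_carrier_def)

text \<open>The rows of the elements of \<open>J\<close> in the component \<open>v\<close> form a space; a vector annihilating it,
  placed in a column, would give a right annihilator of \<open>J\<close>.\<close>
lemma sngl_unit_mem: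
  assumes J: "left_ideal smul J" and ann: "\<And>a. (\<And>s. s \<in> J \<Longrightarrow> s * a = 0) \<Longrightarrow> a = 0"
    and v: "v \<in> I" and k: "k < n v"
  shows "sngl v (mat_unit 0 k) \<in> J"
proof (rule ccontr)
  assume notin: "sngl v (mat_unit 0 k) \<notin> J"
  have J': "0 \<in> J" "\<And>x y. x \<in> J \<Longrightarrow> y \<in> J \<Longrightarrow> x + y \<in> J" 
    "\<And>c x. x \<in> J \<Longrightarrow> smul c x \<in> J" "\<And>a x. x \<in> J \<Longrightarrow> a * x \<in> J"
    using J unfolding left_ideal_def by auto
  let ?row = "\<lambda>w i l. if i = (0::nat) then w l else (0::complex)"
  \<comment> \<open>W collects the vectors that, placed in row 0 of component v, give an element of
    J.\<close>
  define W where "W = {w. (\<forall>l\<ge>n v. w l = 0) \<and> sngl v (?row w) \<in> J}"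
  have row: "?row w \<in> mat_carrier (n v)" if "\<forall>l\<ge>n v. w l = 0" for w
    using that n_pos[OF v] by (auto simp: mat_carrier_def)
  obtain b where b: "b k = 1" "\<And>w. w \<in> W \<Longrightarrow> (\<Sum>l<n v. w l * b l) = 0"
  proof (rule exists_annihilating_vector[of W "n v" k])
    have "?row (\<lambda>_. 0) = (\<lambda>_ _. 0)" by (auto simp: fun_eq_iff)
    then show "(\<lambda>_. 0) \<in> W" using J'(1) sngl_zero by (simp add: W_def)
    show "(\<lambda>l. x l + y l) \<in> W" if "x \<in> W" "y \<in> W" for x y
    proof -
      have "sngl v (?row x) + sngl v (?row y) = sngl v (\<lambda>i l. ?row x i l + ?row y i l)"
        by (rule sngl_add; rule row) (use that in \<open>auto simp: W_def\<close>)
      also have "(\<lambda>i l. ?row x i l + ?row y i l) = ?row (\<lambda>l. x l + y l)" by (auto simp: fun_eq_iff)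
      finally show ?thesis using that J'(2)[of "sngl v (?row x)" "sngl v (?row y)"] by (simp add: W_def)
    qed
    show "(\<lambda>l. c * x l) \<in> W" if "x \<in> W" for c x
    proof -
      have "smul c (sngl v (?row x)) = sngl v (\<lambda>i l. c * ?row x i l)"
        by (rule sngl_smul, rule row) (use that in \<open>auto simp: W_def\<close>)
      also have "(\<lambda>i l. c * ?row x i l) = ?row (\<lambda>l. c * x l)" by (auto simp: fun_eq_iff)
      finally show ?thesis using that J'(3)[of "sngl v (?row x)" c] by (simp add: W_def)
    qed
    show "w l = 0" if "w \<in> W" "n v \<le> l" for w l using that by (simp add: W_def)
    have "?row (\<lambda>l. if l = k then 1 else 0) = mat_unit 0 k" by (auto simp: fun_eq_iff mat_unit_def)
    then show "(\<lambda>l. if l = k then 1 else 0) \<notin> W" using notin by (simp add: W_def)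
  qed blast
  \<comment> \<open>b becomes column 0, so the entries of s m in component v are the pairings of the
    rows of s with b.\<close>
  define m where "m = (\<lambda>i l. if l = (0::nat) \<and> i < n v then b i else 0)"
  have m: "m \<in> mat_carrier (n v)" using n_pos[OF v] by (auto simp: m_def mat_carrier_def)
  have "s * sngl v m = 0" if s: "s \<in> J" for s
  proof -
    have fs: "f s v \<in> mat_carrier (n v)" using iso_carrier[OF v] .
    have rows: "f s v i \<in> W" if i: "i < n v" for i
    proof -
      \<comment> \<open>Left multiplication by the matrix unit (0, i) moves row i into row 0 and
        stays in J, so every row of s belongs to W.\<close>
      have "mat_unit 0 i \<in> mat_carrier (n v)" using n_pos[OF v] i by (auto simp: mat_unit_def mat_carrier_def)
      then have "sngl v (mat_unit 0 i) * s = sngl v (?row (f s v i))"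
        using sngl_mult[OF v] mat_mult_unit_left[OF _ i fs, of 0] n_pos[OF v] by simp
      then have "sngl v (?row (f s v i)) \<in> J" using J'(4)[OF s] by metis
      then show ?thesis using fs by (auto simp: W_def mat_carrier_def)
    qed
    have "mat_mult (n v) (f s v) m = (\<lambda>_ _. 0)"
    proof (intro ext)
      fix i l
      show "mat_mult (n v) (f s v) m i l = 0"
        using b(2)[OF rows, of i] by (cases "l = 0") (auto simp: mat_mult_def m_def)
    qed
    then show ?thesis using mult_sngl[OF v m, of s] sngl_zero by simp
  qed
  then have "sngl v m = 0" by (rule ann)
  then have "sngl v m = sngl v (\<lambda>_ _. 0)" using sngl_zero by simp
  then have "f (sngl v m) v k 0 = f (sngl v (\<lambda>_ _. 0)) v k 0" by simp
  then have "m k 0 = 0" using f_sngl[OF m] f_sngl[of "\<lambda>_ _. 0" v] v by (simp add: mat_carrier_def)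
  then show False using b(1) k by (simp add: m_def)
qed

text \<open>If J had no right annihilator, it would contain the identity of each block, hence the
  identity d of any finite set of blocks. Then x d is in J for every x and agrees with x on these
  blocks, so the closed J is everything.\<close>

lemma product_imp_left_annihilator: left_annihilator_property
  unfolding left_annihilator_property_def closedin_iff[symmetric]
proof (intro allI impI, rule ccontr)
  fix J assume J: "left_ideal smul J" "closedin (seminorm_topology P) J" "J \<noteq> UNIV"
    and "\<nexists>a. a \<noteq> 0 \<and> (\<forall>s\<in>J. s * a = 0)"
  then have ann: "a = 0" if "\<And>s. s \<in> J \<Longrightarrow> s * a = 0" for a using that by blast
  have J': "0 \<in> J" "\<And>x y. x \<in> J \<Longrightarrow> y \<in> J \<Longrightarrow> x + y \<in> J" "\<And>a x. x \<in> J \<Longrightarrow> a * x \<in> J"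
    using J(1) unfolding left_ideal_def by auto
  have diag_carrier: "mat_diag h \<in> mat_carrier m" if "h \<le> m" for h m
    using that by (auto simp: mat_diag_def mat_carrier_def)
  have diag: "sngl v (mat_diag h) \<in> J" if v: "v \<in> I" and "h \<le> n v" for v h
    using \<open>h \<le> n v\<close>
  proof (induction h)
    case 0
    have "mat_diag 0 = (\<lambda>_ _. 0)" by (auto simp: mat_diag_def)
    then show ?case using sngl_zero J'(1) by simp
  next
    case (Suc h)
    have u: "mat_unit j k \<in> mat_carrier (n v)" if "j < n v" "k < n v" for j k
      using that by (auto simp: mat_unit_def mat_carrier_def)
    have n: "0 < n v" "h < n v" using n_pos[OF v] Suc.prems by auto
    \<comment> \<open>The factorization E_hh = E_h0 E_0h carries membership in J from row 0 to the
      diagonal.\<close>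
    have "sngl v (mat_unit h 0) * sngl v (mat_unit 0 h) = sngl v (mat_mult (n v) (mat_unit h 0) (mat_unit 0 h))"
      using mult_sngl[OF v u[OF n(1,2)]] f_sngl[OF u[OF n(2,1)]] v by simp
    also have "mat_mult (n v) (mat_unit h 0) (mat_unit 0 h) = mat_unit h h"
      unfolding mat_mult_unit_left[OF n(2,1) u[OF n]] by (auto simp: mat_unit_def fun_eq_iff)
    finally have "sngl v (mat_unit h h) \<in> J"
      using J'(3)[OF sngl_unit_mem[OF J(1) ann v n(2)]] by metis
    then have "sngl v (mat_diag h) + sngl v (mat_unit h h) \<in> J" using Suc J'(2) by simp
    moreover have "sngl v (mat_diag h) + sngl v (mat_unit h h) = sngl v (\<lambda>j k. mat_diag h j k + mat_unit h h j k)"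
      using diag_carrier[of h "n v"] u[of h h] n by (intro sngl_add) auto
    moreover have "(\<lambda>j k. mat_diag h j k + mat_unit h h j k) = mat_diag (Suc h)"
      by (auto simp: mat_diag_def mat_unit_def fun_eq_iff)
    ultimately show ?case by simp
  qed
  have proj: "\<exists>x\<in>J. f x = (\<lambda>v\<in>I. if v \<in> A then mat_diag (n v) else (\<lambda>_ _. 0))" if "finite A" "A \<subseteq> I" for A
    using that
  proof (induction A rule: finite_induct)
    case empty
    have "f 0 = (\<lambda>v\<in>I. \<lambda>_ _. 0)" using iso_smul[of 0 0] by simp
    then show ?case using J'(1) by (intro bexI[of _ 0]) auto
  next
    case (insert a A)
    then obtain x where x: "x \<in> J" "f x = (\<lambda>v\<in>I. if v \<in> A then mat_diag (n v) else (\<lambda>_ _. 0))"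
      by blast
    have "f (x + sngl a (mat_diag (n a))) = (\<lambda>v\<in>I. if v \<in> insert a A then mat_diag (n v) else (\<lambda>_ _. 0))"
      unfolding iso_add x(2) f_sngl[OF diag_carrier[OF order_refl]] using insert.hyps(2) 
      by (intro ext) (auto simp: restrict_def)
    moreover have "x + sngl a (mat_diag (n a)) \<in> J" using x(1) diag[of a "n a"] insert.prems J'(2) by simp
    ultimately show ?case by blast
  qed
  obtain x where x: "x \<notin> J" using J(3) by blast
  have "openin (seminorm_topology P) (- J)"
    using J(2) by (simp add: closedin_def topspace_seminorm_topology Compl_eq_Diff_UNIV)
  then have "openin (prod_mat_topology I n) (f ` (- J))"
    using homeomorphic_imp_open_map[OF iso_homeomorphic] unfolding open_map_def by blast
  moreover have "f x \<in> f ` (- J)" using x by blast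
  ultimately obtain W where W: "finite {v \<in> I. W v \<noteq> topspace (subtopology euclidean (mat_carrier (n v)))}"
      "f x \<in> Pi\<^sub>E I W" "Pi\<^sub>E I W \<subseteq> f ` (- J)"
    unfolding prod_mat_topology_def openin_product_topology_alt by (elim ballE exE conjE) (rule that, auto)
  let ?A = "{v \<in> I. W v \<noteq> topspace (subtopology euclidean (mat_carrier (n v)))}"
  \<comment> \<open>d is the identity exactly on the coordinates that W restricts; elsewhere the
    component 0 of x d is allowed.\<close>
  obtain d where d: "d \<in> J" "f d = (\<lambda>v\<in>I. if v \<in> ?A then mat_diag (n v) else (\<lambda>_ _. 0))"
    using proj[OF W(1)] by blast
  have "f (x * d) v \<in> W v" if v: "v \<in> I" for v
  proof (cases "v \<in> ?A")
    case True
    then have "f (x * d) v = f x v" using v mat_mult_diag[OF iso_carrier[OF v]] by (simp add: iso_mult d(2))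
    then show ?thesis using W(2) v by (metis PiE_mem)
  next
    case False
    then have "f (x * d) v = (\<lambda>_ _. 0)" using v by (simp add: iso_mult d(2))
    then show ?thesis using False v by (simp add: mat_carrier_def)
  qed
  moreover have "f (x * d) \<in> extensional I" by (simp add: iso_mult)
  ultimately have "f (x * d) \<in> Pi\<^sub>E I W" by (simp add: PiE_iff)
  then have "f (x * d) \<in> f ` (- J)" using W(3) by blast
  then have "x * d \<notin> J" using injD[OF iso_inj] by blast
  then show False using J'(3)[OF d(1)] by blast
qed

end

end

end

section \<open>The directed family of maxima of finitely many seminorms\<close>

definition max_seminorm :: "('a \<Rightarrow> real) set \<Rightarrow> 'a \<Rightarrow> real" where
  "max_seminorm F x = Max (insert 0 ((\<lambda>p. p x) ` F))"

lemma max_seminorm_ge: "finite F \<Longrightarrow> p \<in> F \<Longrightarrow> p x \<le> max_seminorm F x"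
  and max_seminorm_nonneg: "finite F \<Longrightarrow> 0 \<le> max_seminorm F x"
  by (simp_all add: max_seminorm_def)

lemma max_seminorm_cases: 
  assumes "finite F" 
  obtains "max_seminorm F x = 0" | p where "p \<in> F" "max_seminorm F x = p x"
  using Max_in[of "insert 0 ((\<lambda>p. p x) ` F)"] assms unfolding max_seminorm_def by auto

lemma max_seminorm_le_iff: "finite F \<Longrightarrow> 0 \<le> e \<Longrightarrow> max_seminorm F x \<le> e \<longleftrightarrow> (\<forall>p\<in>F. p x \<le> e)"
  by (simp add: max_seminorm_def)

lemma max_seminorm_less_iff: "finite F \<Longrightarrow> 0 < e \<Longrightarrow> max_seminorm F x < e \<longleftrightarrow> (\<forall>p\<in>F. p x < e)"
  by (simp add: max_seminorm_def)

lemma (in star_algebra) cs_max_seminorm: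
  assumes F: "finite F" "\<And>p. p \<in> F \<Longrightarrow> cs p"
  shows "cs (max_seminorm F)"
  unfolding cstar_seminorm_def
proof (intro conjI allI)
  note ge = max_seminorm_ge[OF F(1)] and nn = max_seminorm_nonneg[OF F(1)]
  fix x y c
  show "max_seminorm F (x + y) \<le> max_seminorm F x + max_seminorm F y"
  proof (rule max_seminorm_cases[OF F(1), of "x + y"])
    fix p assume p: "p \<in> F" "max_seminorm F (x + y) = p (x + y)"
    then show ?thesis using cs_triangle[OF F(2)[OF p(1)], of x y] ge[OF p(1), of x] ge[OF p(1), of y] by simp
  qed (simp add: nn)
  show "max_seminorm F (x * y) \<le> max_seminorm F x * max_seminorm F y"
  proof (rule max_seminorm_cases[OF F(1), of "x * y"])
    fix p assume p: "p \<in> F" "max_seminorm F (x * y) = p (x * y)"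
    have "p (x * y) \<le> p x * p y" by (rule cs_mult[OF F(2)[OF p(1)]])
    also have "\<dots> \<le> max_seminorm F x * max_seminorm F y"
      by (intro mult_mono ge p(1) nn cs_nonneg[OF F(2)[OF p(1)]])
    finally show ?thesis using p(2) by simp
  qed (simp add: nn)
  show "max_seminorm F (smul c x) = cmod c * max_seminorm F x"
  proof (rule antisym)
    show "max_seminorm F (smul c x) \<le> cmod c * max_seminorm F x"
      using F nn ge by (simp add: max_seminorm_le_iff cs_smul mult_left_mono)
    show "cmod c * max_seminorm F x \<le> max_seminorm F (smul c x)"
    proof (rule max_seminorm_cases[OF F(1), of x])
      fix p assume p: "p \<in> F" "max_seminorm F x = p x"
      then show ?thesis using ge[OF p(1), of "smul c x"] cs_smul[OF F(2)[OF p(1)]] by simp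
    qed (simp add: nn)
  qed
  show "max_seminorm F (star x * x) = (max_seminorm F x)\<^sup>2"
  proof (rule antisym)
    show "max_seminorm F (star x * x) \<le> (max_seminorm F x)\<^sup>2"
      using F nn ge by (simp add: max_seminorm_le_iff cs_star_mult power_mono cs_nonneg)
    show "(max_seminorm F x)\<^sup>2 \<le> max_seminorm F (star x * x)"
    proof (rule max_seminorm_cases[OF F(1), of x])
      fix p assume p: "p \<in> F" "max_seminorm F x = p x"
      then show ?thesis using ge[OF p(1), of "star x * x"] cs_star_mult[OF F(2)[OF p(1)]] by simp
    qed (simp add: nn)
  qed
qed

text \<open>First the defining predicate is shown to be a topology, so that \<open>topology\<close>
  really returns it; then the condition for all p in F is one condition on
  \<open>max_seminorm F\<close>.\<close>

lemma openin_seminorm_topology: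
  fixes P :: "('a::ab_group_add \<Rightarrow> real) set"
  shows "openin (seminorm_topology P) S \<longleftrightarrow>
    (\<forall>x\<in>S. \<exists>q\<in>{max_seminorm F | F. finite F \<and> F \<subseteq> P}. \<exists>e>0. {y. q (y - x) < e} \<subseteq> S)"
proof -
  let ?L = "\<lambda>U. \<forall>x\<in>U. \<exists>F e. finite F \<and> F \<subseteq> P \<and> e > 0 \<and> {y. \<forall>p\<in>F. p (y - x) < e} \<subseteq> U"
  have "istopology ?L"
    unfolding istopology_def
  proof (intro conjI allI impI)
    fix S T assume S: "?L S" and T: "?L T"
    show "?L (S \<inter> T)"
    proof
      fix x assume x: "x \<in> S \<inter> T"
      have "x \<in> S" "x \<in> T" using x by auto
      from bspec[OF S this(1)] obtain F e 
        where F: "finite F \<and> F \<subseteq> P \<and> e > 0 \<and> {y. \<forall>p\<in>F. p (y - x) < e} \<subseteq> S"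
        by (elim exE) (rule that)
      from bspec[OF T \<open>x \<in> T\<close>] obtain G d 
        where G: "finite G \<and> G \<subseteq> P \<and> d > 0 \<and> {y. \<forall>p\<in>G. p (y - x) < d} \<subseteq> T"
        by (elim exE) (rule that)
      show "\<exists>F e. finite F \<and> F \<subseteq> P \<and> e > 0 \<and> {y. \<forall>p\<in>F. p (y - x) < e} \<subseteq> S \<inter> T"
        using F G by (intro exI[of _ "F \<union> G"] exI[of _ "min e d"]) auto
    qed
  next
    fix K assume "\<forall>S\<in>K. ?L S"
    then show "?L (\<Union>K)" by (meson Union_iff Union_upper subset_trans)
  qed
  then have "openin (seminorm_topology P) S \<longleftrightarrow> ?L S"
    unfolding seminorm_topology_def by (simp add: topology_inverse')
  also have "\<dots> \<longleftrightarrow> (\<forall>x\<in>S. \<exists>q\<in>{max_seminorm F | F. finite F \<and> F \<subseteq> P}. \<exists>e>0. {y. q (y - x) < e} \<subseteq> S)"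
  proof (intro ball_cong refl)
    fix x :: 'a
    have eq: "{y. max_seminorm F (y - x) < e} = {y. \<forall>p\<in>F. p (y - x) < e}" if "finite F" "e > 0" for F e
      using that by (simp add: max_seminorm_less_iff)
    show "(\<exists>F e. finite F \<and> F \<subseteq> P \<and> e > 0 \<and> {y. \<forall>p\<in>F. p (y - x) < e} \<subseteq> S) \<longleftrightarrow>
       (\<exists>q\<in>{max_seminorm F | F. finite F \<and> F \<subseteq> P}. \<exists>e>0. {y. q (y - x) < e} \<subseteq> S)" (is "?l \<longleftrightarrow> ?r")
    proof
      assume ?l
      then obtain F e where F: "finite F" "F \<subseteq> P" "e > 0" "{y. \<forall>p\<in>F. p (y - x) < e} \<subseteq> S" by blast
      then have "\<exists>e>0. {y. max_seminorm F (y - x) < e} \<subseteq> S" unfolding eq[OF F(1,3), symmetric] by blast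
      then show ?r using F(1,2) by (intro bexI[of _ "max_seminorm F"]) auto
    next
      assume ?r
      then obtain F e where F: "finite F" "F \<subseteq> P" "e > 0" "{y. max_seminorm F (y - x) < e} \<subseteq> S" by blast
      then have "finite F \<and> F \<subseteq> P \<and> e > 0 \<and> {y. \<forall>p\<in>F. p (y - x) < e} \<subseteq> S" unfolding eq[OF F(1,3)] by blast
      then show ?l by blast
    qed
  qed
  finally show ?thesis .
qed

text \<open>Completeness passes over because Cauchy filters are tested on singletons {p}, while
  convergence for a maximum is a finite conjunction of convergences.\<close>

lemma lcs_algebra_max_seminorms:
  assumes "locally_cstar_algebra smul star P"
  shows "lcs_algebra smul star {max_seminorm F | F. finite F \<and> F \<subseteq> P}" (is "lcs_algebra _ _ ?Q")
proof -
  note A = assms[unfolded locally_cstar_algebra_def]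
  interpret star_algebra smul star using A by unfold_locales auto
  have single: "max_seminorm {p} \<in> ?Q" if "p \<in> P" for p using that by blast
  show ?thesis
  proof
    show "cs q" if "q \<in> ?Q" for q using that A by (auto intro!: cs_max_seminorm)
  next
    fix x assume x: "\<And>q. q \<in> ?Q \<Longrightarrow> q x = 0"
    have "p x = 0" if "p \<in> P" for p
      using x[OF single[OF that]] max_seminorm_ge[of "{p}" p x] cs_nonneg[of p x] A that by force
    then show "x = 0" using A by blast
  next
    show "sn_complete ?Q"
      unfolding sn_complete_def
    proof (intro allI impI)
      fix \<F> assume c: "sn_cauchy ?Q \<F>"
      have "sn_cauchy P \<F>"
        unfolding sn_cauchy_def
      proof (intro conjI ballI allI impI)
        show "\<F> \<noteq> bot" using c by (simp add: sn_cauchy_def)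
        fix p e assume p: "p \<in> P" and e: "(0::real) < e"
        have "\<forall>\<^sub>F (x, y) in \<F> \<times>\<^sub>F \<F>. max_seminorm {p} (x - y) < e"
          using c single[OF p] e unfolding sn_cauchy_def by blast
        then show "\<forall>\<^sub>F (x, y) in \<F> \<times>\<^sub>F \<F>. p (x - y) < e"
          using e by (simp add: max_seminorm_less_iff)
      qed
      then obtain a where a: "sn_converges P \<F> a" using A unfolding sn_complete_def by blast
      have "sn_converges ?Q \<F> a"
        unfolding sn_converges_def
      proof (intro ballI allI impI)
        fix q e assume "q \<in> ?Q" and e: "(0::real) < e"
        then obtain F where F: "q = max_seminorm F" "finite F" "F \<subseteq> P" by blast
        have "\<forall>\<^sub>F x in \<F>. \<forall>p\<in>F. p (x - a) < e"
          using a F e unfolding sn_converges_def by (intro eventually_ball_finite) auto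
        then show "\<forall>\<^sub>F x in \<F>. q (x - a) < e" using F e by (simp add: max_seminorm_less_iff)
      qed
      then show "\<exists>a. sn_converges ?Q \<F> a" ..
    qed
  qed
qed

theorem theorem3p29:
  fixes smul :: "complex \<Rightarrow> 'a::ring_1 \<Rightarrow> 'a"
    and star :: "'a \<Rightarrow> 'a"
    and P :: "('a \<Rightarrow> real) set"
  assumes "locally_cstar_algebra smul star P"
  shows "(annihilator_algebra smul P \<longrightarrow>
            (\<exists>(I::'a set) n f. (\<forall>v\<in>I. 1 \<le> n v) \<and> top_star_iso_prod_mat smul star P I n f))
       \<and> (\<forall>(I::'i set) n f. (\<forall>v\<in>I. 1 \<le> n v) \<and> top_star_iso_prod_mat smul star P I n f
            \<longrightarrow> annihilator_algebra smul P)"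
proof -
  \<comment> \<open>The argument runs with the finite maxima as \<open>Q\<close>, while ideals are
    closed in the topology of \<open>P\<close>; \<open>T\<close> links the two.\<close>
  interpret lcs_algebra smul star "{max_seminorm F | F. finite F \<and> F \<subseteq> P}"
    by (rule lcs_algebra_max_seminorms[OF assms])
  note T = openin_seminorm_topology[of P]
  show ?thesis
  proof (intro conjI impI allI; (elim conjE)?)
    assume "annihilator_algebra smul P"
    then have left_annihilator_property by (rule annihilator_algebra_imp_left[OF T])
    then show "\<exists>(I::'a set) n f. (\<forall>v\<in>I. 1 \<le> n v) \<and> top_star_iso_prod_mat smul star P I n f"
      using T by (rule left_annihilator_imp_product)
  next
    fix I :: "'i set" and n f
    assume "\<forall>v\<in>I. 1 \<le> n v" "top_star_iso_prod_mat smul star P I n f"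
    then have left_annihilator_property
      using product_imp_left_annihilator[OF T, of I n f] by blast
    then show "annihilator_algebra smul P" by (rule left_imp_annihilator_algebra[OF T])
  qed
qed

end
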